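(* Suppose $J=(J_1,\dots,J_g)\in M_d(\mathbb C)^g$ is linearly independent and spans an algebra, let $\Xi\in M_g(\mathbb C)^g$ be the resulting convexotonic tuple, determined by $$J_kJ_j=\sum_{s=1}^g(\Xi_j)_{k,s}J_s\qquad(1\le j,k\le g),$$ and let $q$ be the convexotonic (birational) map $q(x)=x(I+\Lambda_\Xi(x))^{-1}$, with (convexotonic) inverse $p(x)=x(I-\Lambda_\Xi(x))^{-1}$. Then (1) the domain of $q$ contains $\mathcal D_J$; (2) $q$ is a bianalytic map between $\operatorname{int}(\mathcal D_J)$ and $\operatorname{int}(\mathcal B_J)$; that is, $p$, the inverse of $q$, maps $\operatorname{int}(\mathcal B_J)$ into $\operatorname{int}(\mathcal D_J)$. In particular, $q$ is proper (as a map from $\operatorname{int}(\mathcal D_J)$ to $\operatorname{int}(\mathcal B_J)$); (3) $q$ maps the boundary of $\mathcal D_J$ into the boundary of $\mathcal B_J$; (4) if, in addition, $\mathcal D_J$ is bounded, then $q$ is a bianalytic map between $\mathcal D_J$ and $\mathcal B_J$. In particular, the domain of $p$ contains $\mathcal B_J$.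
   Context: $M_n(\mathbb C)^g$ is the set of $g$-tuples of $n\times n$ complex matrices, and $M(\mathbb C)^g=(M_n(\mathbb C)^g)_n$. For $A\in M_d(\mathbb C)^g$ and $X\in M_n(\mathbb C)^g$ let $\Lambda_A(X)=\sum_j A_j\otimes X_j$. The free spectrahedron is $\mathcal D_A=(\mathcal D_A(n))_n$ with $\mathcal D_A(n)=\{X\in M_n(\mathbb C)^g: I+\Lambda_A(X)+\Lambda_A(X)^*\succeq0\}$, and the spectraball is $\mathcal B_A=(\mathcal B_A(n))_n$ with $\mathcal B_A(n)=\{X\in M_n(\mathbb C)^g:\|\Lambda_A(X)\|\le1\}$. Interiors ($\operatorname{int}$) and boundaries are taken levelwise, i.e. for each $n$ in $M_n(\mathbb C)^g$. $\mathcal D_A$ is bounded if there is a constant $c$ with $\|X_j\|\le c$ for all $j$, $n$ and $X\in\mathcal D_A(n)$. The tuple $J$ is linearly independent if $\{J_1,\dots,J_g\}$ is; it spans an algebra if the linear span of $\{J_1,\dots,J_g\}$ is closed under multiplication. A tuple $\Xi\in M_g(\mathbb C)^g$ is convexotonic if $\Xi_k\Xi_j=\sum_{s=1}^g(\Xi_j)_{k,s}\Xi_s$ for all $1\le j,k\le g$; the tuple $\Xi$ determined by $J$ as in the statement is convexotonic. For a convexotonic $\Xi$, the expressions $p(x)=x(I-\Lambda_\Xi(x))^{-1}$ and $q(x)=x(I+\Lambda_\Xi(x))^{-1}$ denote the free mappings with components $p^i(x)=\sum_{j=1}^gx_j[(I-\Lambda_\Xi(x))^{-1}]_{j,i}$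 and $q^i(x)=\sum_{j=1}^gx_j[(I+\Lambda_\Xi(x))^{-1}]_{j,i}$; for $X\in M_n(\mathbb C)^g$, $[\,\cdot\,]_{j,i}$ denotes the $(j,i)$ block, of size $n\times n$, of the $g\times g$ block matrix. The domain of $p$ (resp. $q$) consists of those $X$ for which $I-\Lambda_\Xi(X)$ (resp. $I+\Lambda_\Xi(X)$) is invertible. The maps $p$ and $q$ are inverses of one another. A free mapping $f=(f_n)_n$ acts levelwise and respects direct sums and intertwining ($X_jT=TY_j$ for all $j$ implies $f^i(X)T=Tf^i(Y)$ for each component $f^i$). It is analytic if each $f_n$ is analytic. A bianalytic map is a bijective free analytic map with free analytic inverse; for the non-open sets $\mathcal D_J,\mathcal B_J$, the maps are restrictions of the rational maps $q,p$, which are analytic on their (open) domains. A free mapping $f:\mathcal U\to\mathcal V$ between open free sets is proper if for each $n$ the map $f_n:\mathcal U_n\to\mathcal V_n$ is proper (inverse images of compact sets are compact). *)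

theory Defs
  imports "HOL-Analysis.Analysis" "Jordan_Normal_Form.Gauss_Jordan_Elimination"
    "Jordan_Normal_Form.Schur_Decomposition"
begin

text \<open>A tuple in \<open>M\<^sub>n(\<complex>)\<^sup>g\<close> is a list of length \<open>g\<close>; indices start at 0, so \<open>X ! j\<close> is the
  (j+1)-st component.  A free set is a family indexed by the level \<open>n\<close>, of which only the levels
  \<open>n \<ge> 1\<close> are ever used.  Free mappings are partial functions at each level.\<close>

type_synonym mtuple = "complex mat list"
type_synonym free_set = "nat \<Rightarrow> mtuple set"
type_synonym free_map = "nat \<Rightarrow> mtuple \<Rightarrow> mtuple option"

definition mat_tuples :: "nat \<Rightarrow> nat \<Rightarrow> mtuple set" where
  "mat_tuples g n = {X. length X = g \<and> set X \<subseteq> carrier_mat n n}"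

subsection \<open>Linear pencils, free spectrahedra and spectraballs\<close>

definition kron :: "complex mat \<Rightarrow> complex mat \<Rightarrow> complex mat" where
  "kron A B = mat (dim_row A * dim_row B) (dim_col A * dim_col B)
     (\<lambda>(r, c). A $$ (r div dim_row B, c div dim_col B) * B $$ (r mod dim_row B, c mod dim_col B))"

definition lin_pencil :: "nat \<Rightarrow> nat \<Rightarrow> mtuple \<Rightarrow> mtuple \<Rightarrow> complex mat" where
  "lin_pencil d n A X =
     mat (d * n) (d * n) (\<lambda>rc. \<Sum>j<length A. kron (A ! j) (X ! j) $$ rc)"

definition pos_semidef :: "nat \<Rightarrow> complex mat \<Rightarrow> bool" where
  "pos_semidef N M \<longleftrightarrow> M \<in> carrier_mat N N \<and> mat_adjoint M = M \<and>
     (\<forall>v \<in> carrier_vec N. 0 \<le> Re ((M *\<^sub>v v) \<bullet>c v))"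

definition vnorm :: "complex vec \<Rightarrow> real" where
  "vnorm v = L2_set (\<lambda>i. cmod (v $ i)) {..<dim_vec v}"

definition op_norm :: "complex mat \<Rightarrow> real" where
  "op_norm M = Inf {c. 0 \<le> c \<and> (\<forall>v \<in> carrier_vec (dim_col M). vnorm (M *\<^sub>v v) \<le> c * vnorm v)}"

definition spectrahedron :: "nat \<Rightarrow> mtuple \<Rightarrow> free_set" where
  "spectrahedron d A n = {X \<in> mat_tuples (length A) n.
     pos_semidef (d * n)
       (1\<^sub>m (d * n) + lin_pencil d n A X + mat_adjoint (lin_pencil d n A X))}"

definition spectraball :: "nat \<Rightarrow> mtuple \<Rightarrow> free_set" where
  "spectraball d A n = {X \<in> mat_tuples (length A) n. op_norm (lin_pencil d n A X) \<le> 1}"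

definition free_bounded :: "nat \<Rightarrow> free_set \<Rightarrow> bool" where
  "free_bounded g S \<longleftrightarrow> (\<exists>c. \<forall>n>0. \<forall>X \<in> S n. \<forall>j<g. op_norm (X ! j) \<le> c)"

subsection \<open>Linear independence and algebras\<close>

definition lin_comb :: "nat \<Rightarrow> (nat \<Rightarrow> complex) \<Rightarrow> mtuple \<Rightarrow> complex mat" where
  "lin_comb d c A = mat d d (\<lambda>rc. \<Sum>j<length A. c j * (A ! j) $$ rc)"

definition lin_indep_tuple :: "nat \<Rightarrow> mtuple \<Rightarrow> bool" where
  "lin_indep_tuple d A \<longleftrightarrow> (\<forall>c. lin_comb d c A = 0\<^sub>m d d \<longrightarrow> (\<forall>j<length A. c j = 0))"

definition mat_span :: "nat \<Rightarrow> mtuple \<Rightarrow> complex mat set" where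
  "mat_span d A = range (\<lambda>c. lin_comb d c A)"

definition spans_algebra :: "nat \<Rightarrow> mtuple \<Rightarrow> bool" where
  "spans_algebra d A \<longleftrightarrow> (\<forall>M \<in> mat_span d A. \<forall>N \<in> mat_span d A. M * N \<in> mat_span d A)"

subsection \<open>The rational maps of a convexotonic tuple\<close>

definition mat_block :: "nat \<Rightarrow> complex mat \<Rightarrow> nat \<Rightarrow> nat \<Rightarrow> complex mat" where
  "mat_block n M j i = mat n n (\<lambda>(a, b). M $$ (j * n + a, i * n + b))"

text \<open>The row \<open>(X\<^sub>1, \<dots>, X\<^sub>g)\<close> times a \<open>g \<times> g\<close> block matrix with blocks of size \<open>n \<times> n\<close>.\<close>

definition row_times_block :: "nat \<Rightarrow> nat \<Rightarrow> mtuple \<Rightarrow> complex mat \<Rightarrow> mtuple" where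
  "row_times_block g n X R =
     map (\<lambda>i. mat n n (\<lambda>ab. \<Sum>j<g. (X ! j * mat_block n R j i) $$ ab)) [0..<g]"

definition convexotonic_q :: "mtuple \<Rightarrow> free_map" where
  "convexotonic_q \<Xi> n X =
     (let g = length \<Xi>; M = 1\<^sub>m (g * n) + lin_pencil g n \<Xi> X in
      if X \<in> mat_tuples g n \<and> invertible_mat M
      then Some (row_times_block g n X (the (mat_inverse M))) else None)"

definition convexotonic_p :: "mtuple \<Rightarrow> free_map" where
  "convexotonic_p \<Xi> n X =
     (let g = length \<Xi>; M = 1\<^sub>m (g * n) - lin_pencil g n \<Xi> X in
      if X \<in> mat_tuples g n \<and> invertible_mat M
      then Some (row_times_block g n X (the (mat_inverse M))) else None)"

subsection \<open>The topology of \<open>M\<^sub>n(\<complex>)\<^sup>g\<close>\<close>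

definition coords :: "nat \<Rightarrow> nat \<Rightarrow> (nat \<times> nat \<times> nat) set" where
  "coords g n = {..<g} \<times> {..<n} \<times> {..<n}"

definition coord :: "mtuple \<Rightarrow> nat \<times> nat \<times> nat \<Rightarrow> complex" where
  "coord X = (\<lambda>(j, a, b). (X ! j) $$ (a, b))"

text \<open>The Euclidean distance of \<open>\<complex>\<^bsup>g n n\<^esup>\<close>; any other norm induces the same topology.\<close>

definition tuple_dist :: "nat \<Rightarrow> nat \<Rightarrow> mtuple \<Rightarrow> mtuple \<Rightarrow> real" where
  "tuple_dist g n X Y = L2_set (\<lambda>k. cmod (coord X k - coord Y k)) (coords g n)"

lemma mat_tuples_eqI:
  assumes "X \<in> mat_tuples g n" "Y \<in> mat_tuples g n"
    and "\<And>k. k \<in> coords g n \<Longrightarrow> coord X k = coord Y k"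
  shows "X = Y"
proof (rule nth_equalityI)
  show "length X = length Y" using assms by (simp add: mat_tuples_def)
next
  fix j assume "j < length X"
  then have j: "j < g" "X ! j \<in> carrier_mat n n" "Y ! j \<in> carrier_mat n n"
    using assms(1,2) nth_mem[of j X] nth_mem[of j Y] by (auto simp: mat_tuples_def)
  show "X ! j = Y ! j"
  proof (rule eq_matI)
    fix a b assume "a < dim_row (Y ! j)" "b < dim_col (Y ! j)"
    then show "X ! j $$ (a, b) = Y ! j $$ (a, b)"
      using assms(3)[of "(j, a, b)"] j by (auto simp: coords_def coord_def)
  qed (use j in auto)
qed

lemma Metric_space_mat_tuples: "Metric_space (mat_tuples g n) (tuple_dist g n)"
proof
  show "0 \<le> tuple_dist g n X Y" for X Y by (simp add: tuple_dist_def)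
  show "tuple_dist g n X Y = tuple_dist g n Y X" for X Y
    by (simp add: tuple_dist_def norm_minus_commute)
  have fin: "finite (coords g n)" by (simp add: coords_def)
  show "tuple_dist g n X Y = 0 \<longleftrightarrow> X = Y"
    if "X \<in> mat_tuples g n" "Y \<in> mat_tuples g n" for X Y
    using mat_tuples_eqI[OF that] by (auto simp: tuple_dist_def L2_set_eq_0_iff[OF fin])
  show "tuple_dist g n X Z \<le> tuple_dist g n X Y + tuple_dist g n Y Z" for X Y Z
  proof -
    have "tuple_dist g n X Z \<le>
        L2_set (\<lambda>k. cmod (coord X k - coord Y k) + cmod (coord Y k - coord Z k)) (coords g n)"
      unfolding tuple_dist_def
    proof (intro L2_set_mono)
      show "cmod (coord X k - coord Z k) \<le> cmod (coord X k - coord Y k) + cmod (coord Y k - coord Z k)" for k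
        using norm_triangle_ineq[of "coord X k - coord Y k" "coord Y k - coord Z k"] by simp
    qed simp
    also have "\<dots> \<le> tuple_dist g n X Y + tuple_dist g n Y Z"
      unfolding tuple_dist_def by (rule L2_set_triangle_ineq)
    finally show ?thesis .
  qed
qed

definition tuple_topology :: "nat \<Rightarrow> nat \<Rightarrow> mtuple topology" where
  "tuple_topology g n = Metric_space.mtopology (mat_tuples g n) (tuple_dist g n)"

definition free_interior :: "nat \<Rightarrow> free_set \<Rightarrow> free_set" where
  "free_interior g S n = tuple_topology g n interior_of S n"

definition free_boundary :: "nat \<Rightarrow> free_set \<Rightarrow> free_set" where
  "free_boundary g S n = tuple_topology g n frontier_of S n"

subsection \<open>Free analytic mappings\<close>

definition free_maps_into :: "free_set \<Rightarrow> free_set \<Rightarrow> free_map \<Rightarrow> bool" where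
  "free_maps_into S T f \<longleftrightarrow> (\<forall>n>0. \<forall>X \<in> S n. \<exists>Y \<in> T n. f n X = Some Y)"

definition direct_sum :: "mtuple \<Rightarrow> mtuple \<Rightarrow> mtuple" where
  "direct_sum X Y = map2 (\<lambda>A B. diag_block_mat [A, B]) X Y"

definition respects_direct_sums :: "free_set \<Rightarrow> free_map \<Rightarrow> bool" where
  "respects_direct_sums S f \<longleftrightarrow>
     (\<forall>n>0. \<forall>m>0. \<forall>X \<in> S n. \<forall>Y \<in> S m. direct_sum X Y \<in> S (n + m) \<longrightarrow>
        the (f (n + m) (direct_sum X Y)) = direct_sum (the (f n X)) (the (f m Y)))"

definition respects_intertwining :: "nat \<Rightarrow> free_set \<Rightarrow> free_map \<Rightarrow> bool" where
  "respects_intertwining g S f \<longleftrightarrow>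
     (\<forall>n>0. \<forall>m>0. \<forall>X \<in> S n. \<forall>Y \<in> S m. \<forall>T \<in> carrier_mat n m.
        (\<forall>j<g. X ! j * T = T * Y ! j) \<longrightarrow>
        (\<forall>i<g. the (f n X) ! i * T = T * the (f m Y) ! i))"

definition free_mapping :: "nat \<Rightarrow> free_set \<Rightarrow> free_map \<Rightarrow> bool" where
  "free_mapping g S f \<longleftrightarrow>
     free_maps_into S (mat_tuples g) f \<and> respects_direct_sums S f \<and> respects_intertwining g S f"

text \<open>Complex (Frechet) differentiability of a scalar function of the \<open>g n n\<close> matrix entries;
  \<open>D k\<close> is the partial derivative in the entry \<open>k\<close>.\<close>

definition complex_diff_at :: "nat \<Rightarrow> nat \<Rightarrow> (mtuple \<Rightarrow> complex) \<Rightarrow> mtuple \<Rightarrow> bool" where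
  "complex_diff_at g n \<phi> X \<longleftrightarrow>
     (\<exists>D. \<forall>\<epsilon>>0. \<exists>\<delta>>0. \<forall>Y \<in> mat_tuples g n. tuple_dist g n X Y < \<delta> \<longrightarrow>
        cmod (\<phi> Y - \<phi> X - (\<Sum>k \<in> coords g n. D k * (coord Y k - coord X k)))
          \<le> \<epsilon> * tuple_dist g n X Y)"

text \<open>As for \<open>analytic_on\<close> in one variable, a map is analytic on an arbitrary set if it is complex
  differentiable on an open neighbourhood of each point (which here has to lie in the domain).\<close>

definition free_analytic_on :: "nat \<Rightarrow> free_set \<Rightarrow> free_map \<Rightarrow> bool" where
  "free_analytic_on g S f \<longleftrightarrow>
     (\<forall>n>0. \<forall>X \<in> S n. \<exists>U. openin (tuple_topology g n) U \<and> X \<in> U \<and> U \<subseteq> dom (f n) \<and>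
        (\<forall>Y \<in> U. \<forall>k \<in> coords g n. complex_diff_at g n (\<lambda>Z. coord (the (f n Z)) k) Y))"

text \<open>\<open>f\<close> is a bianalytic map from \<open>S\<close> onto \<open>T\<close> with inverse \<open>h\<close>.\<close>

definition bianalytic :: "nat \<Rightarrow> free_set \<Rightarrow> free_set \<Rightarrow> free_map \<Rightarrow> free_map \<Rightarrow> bool" where
  "bianalytic g S T f h \<longleftrightarrow>
     free_maps_into S T f \<and> free_maps_into T S h \<and>
     (\<forall>n>0. \<forall>X \<in> S n. h n (the (f n X)) = Some X) \<and>
     (\<forall>n>0. \<forall>Y \<in> T n. f n (the (h n Y)) = Some Y) \<and>
     free_mapping g S f \<and> free_analytic_on g S f \<and>
     free_mapping g T h \<and> free_analytic_on g T h"

definition free_proper :: "nat \<Rightarrow> free_set \<Rightarrow> free_set \<Rightarrow> free_map \<Rightarrow> bool" where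
  "free_proper g S T f \<longleftrightarrow> free_maps_into S T f \<and>
     (\<forall>n>0. \<forall>K. compactin (subtopology (tuple_topology g n) (T n)) K \<longrightarrow>
        compactin (subtopology (tuple_topology g n) (S n)) {X \<in> S n. the (f n X) \<in> K})"

end

(* Tensoring with J identifies a tuple X with Lambda_J(X) and turns the convexotonic product into
   matrix multiplication, so that Y = q(X) means (I - Lambda_J(Y)) (I + Lambda_J(X)) = I. Hence q
   acts as the Cayley-type transform Lambda_J(X) (I + Lambda_J(X))^(-1), and p is the same map with
   J and Xi replaced by their negatives. For v = u + Lambda_J(X) u the identity
     |v|^2 - |Lambda_J(Y) v|^2 = |u + Lambda_J(X) u|^2 - |Lambda_J(X) u|^2
   shows that X is in D_J if and only if q(X) is in B_J. Interiors correspond because q and p are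
   continuous with open domains. If Y in B_J had Lambda_J(Y) v = v for some nonzero v, then
   I + Lambda_J(p(tY)) would have the eigenvalue 1/(1-t), which is unbounded as t tends to 1. *)

theory Submission
  imports Defs
begin

text \<open>The obstacle is a mismatch of sizes: the domains of q and p are decided by a matrix of
  size \<open>g * n\<close> built from \<Xi>, whereas the two sets only control a matrix of size
  \<open>d * n\<close> built from J. Row k of \<open>\<Xi> ! j\<close> lists the coordinates of
  \<open>J ! k * J ! j\<close>, so both matrices represent the same operation, right multiplication
  by 1 + X in the algebra span J \<otimes> M_n with a unit adjoined, once on coordinate rows and
  once on pencils. Linear independence of J carries invertibility from the second to the first and
  recovers a tuple from its pencil. On the spectrahedron the defining inequality itself excludes the
  eigenvalue -1 of the pencil. On the spectraball nothing so direct excludes the eigenvalue 1: for g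
  = d = 1 and J = 1 the spectrahedron is at level 1 the half-plane Re x \<ge> -1/2, the spectraball
  is the unit disc, and p(y) = y/(1 - y) has a pole at 1. So p needs two separate arguments: an
  interior point stays in the ball after a dilation by some t > 1, and on the rest of the ball
  boundedness of the spectrahedron is used.\<close>

unbundle no vec_syntax

subsection \<open>Pencils and the convexotonic product\<close>

lemma sum_lessThan_mult:
  fixes f :: "nat \<Rightarrow> 'a::comm_monoid_add"
  shows "(\<Sum>r<d * n. f r) = (\<Sum>i<d. \<Sum>a<n. f (i * n + a))"
proof -
  have "(\<Sum>r<d * n. f r) = (\<Sum>i<d. sum f {i * n..<i * n + n})"
    by (rule sum.nat_group[symmetric])
  also have "\<dots> = (\<Sum>i<d. \<Sum>a<n. f (i * n + a))"
  proof (rule sum.cong[OF refl])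
    fix i
    show "sum f {i * n..<i * n + n} = (\<Sum>a<n. f (i * n + a))"
      using sum.shift_bounds_nat_ivl[of f 0 "i * n" n]
      by (simp add: lessThan_atLeast0 add.commute)
  qed
  finally show ?thesis .
qed

lemma mult_add_less:
  fixes i a d n :: nat
  assumes "i < d" "a < n"
  shows "i * n + a < d * n"
proof -
  have "i * n + a < Suc i * n" using assms by simp
  also have "\<dots> \<le> d * n" using assms by (intro mult_le_mono1) simp
  finally show ?thesis .
qed

lemma div_less_of_mult: "(r::nat) < d * n \<Longrightarrow> r div n < d"
  by (simp add: less_mult_imp_div_less)

lemma mod_less_of_mult: "(r::nat) < d * n \<Longrightarrow> r mod n < n"
  by (cases n) auto

lemma mat_tuplesD:
  assumes "X \<in> mat_tuples g n"
  shows "length X = g" "j < g \<Longrightarrow> X ! j \<in> carrier_mat n n"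
    "j < g \<Longrightarrow> dim_row (X ! j) = n" "j < g \<Longrightarrow> dim_col (X ! j) = n"
proof -
  show 1: "length X = g" using assms by (simp add: mat_tuples_def)
  show 2: "j < g \<Longrightarrow> X ! j \<in> carrier_mat n n" using assms 1 nth_mem by (auto simp: mat_tuples_def)
  show "j < g \<Longrightarrow> dim_row (X ! j) = n" "j < g \<Longrightarrow> dim_col (X ! j) = n" using 2 by auto
qed

lemma mat_tuples_map_upt:
  "(\<And>i. i < g \<Longrightarrow> f i \<in> carrier_mat n n) \<Longrightarrow> map f [0..<g] \<in> mat_tuples g n"
  by (auto simp: mat_tuples_def)

lemma mat_mult_index_sum:
  assumes "i < dim_row A" "j < dim_col B" "dim_row B = dim_col A"
  shows "(A * B) $$ (i, j) = (\<Sum>k<dim_col A. A $$ (i, k) * B $$ (k, j))"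
  using assms by (simp add: scalar_prod_def lessThan_atLeast0)

lemma lin_pencil_carrier: "lin_pencil d n A X \<in> carrier_mat (d * n) (d * n)"
  by (simp add: lin_pencil_def)

lemma lin_pencil_dim [simp]:
  "dim_row (lin_pencil d n A X) = d * n" "dim_col (lin_pencil d n A X) = d * n"
  by (simp_all add: lin_pencil_def)

lemma lin_pencil_index:
  assumes "A \<in> mat_tuples g d" "X \<in> mat_tuples g n" "r < d * n" "c < d * n"
  shows "lin_pencil d n A X $$ (r, c) =
    (\<Sum>j<g. (A ! j) $$ (r div n, c div n) * (X ! j) $$ (r mod n, c mod n))"
  using assms mat_tuplesD[OF assms(1)] mat_tuplesD[OF assms(2)]
  by (auto simp: lin_pencil_def kron_def intro!: sum.cong)

lemma lin_pencil_index':
  assumes "A \<in> mat_tuples g d" "X \<in> mat_tuples g n" "i < d" "l < d" "a < n" "b < n"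
  shows "lin_pencil d n A X $$ (i * n + a, l * n + b) =
    (\<Sum>j<g. (A ! j) $$ (i, l) * (X ! j) $$ (a, b))"
  using lin_pencil_index[OF assms(1,2) mult_add_less[OF assms(3,5)] mult_add_less[OF assms(4,6)]] assms
  by simp

text \<open>With the tuple laid out as a single row of blocks, the componentwise formulas for q and
  p become ordinary matrix products, to which associativity and cancellation apply.\<close>

definition block_row :: "nat \<Rightarrow> nat \<Rightarrow> mtuple \<Rightarrow> complex mat" where
  "block_row g n X = mat n (g * n) (\<lambda>(a, r). (X ! (r div n)) $$ (a, r mod n))"

lemma block_row_carrier: "block_row g n X \<in> carrier_mat n (g * n)"
  by (simp add: block_row_def)

lemma block_row_dim [simp]: "dim_row (block_row g n X) = n" "dim_col (block_row g n X) = g * n"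
  by (simp_all add: block_row_def)

lemma block_row_index:
  assumes "i < g" "a < n" "b < n"
  shows "block_row g n X $$ (a, i * n + b) = (X ! i) $$ (a, b)"
  using assms mult_add_less[of i g b n] by (simp add: block_row_def)

lemma block_row_inj:
  assumes "X \<in> mat_tuples g n" "Y \<in> mat_tuples g n" "block_row g n X = block_row g n Y"
  shows "X = Y"
proof (rule mat_tuples_eqI[OF assms(1,2)])
  fix k assume "k \<in> coords g n"
  then obtain i a b where k: "k = (i, a, b)" "i < g" "a < n" "b < n"
    by (auto simp: coords_def)
  show "coord X k = coord Y k"
    using block_row_index[of i g a n b X] block_row_index[of i g a n b Y] k assms(3)
    by (simp add: coord_def)
qed

lemma row_times_block_tuple: "row_times_block g n X R \<in> mat_tuples g n"
  unfolding row_times_block_def by (rule mat_tuples_map_upt) simp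

lemma row_times_block_index:
  assumes X: "X \<in> mat_tuples g n" and "i < g" "a < n" "b < n"
  shows "(row_times_block g n X R ! i) $$ (a, b) =
    (\<Sum>j<g. \<Sum>c<n. (X ! j) $$ (a, c) * R $$ (j * n + c, i * n + b))"
  using assms mat_tuplesD[OF X]
  by (auto simp: row_times_block_def mat_block_def mat_mult_index_sum simp del: index_mult_mat
      intro!: sum.cong)

lemma block_row_row_times_block:
  assumes X: "X \<in> mat_tuples g n" and R: "R \<in> carrier_mat (g * n) (g * n)"
  shows "block_row g n (row_times_block g n X R) = block_row g n X * R"
proof (rule eq_matI)
  fix a r assume "a < dim_row (block_row g n X * R)" "r < dim_col (block_row g n X * R)"
  then have a: "a < n" and r: "r < g * n" using R by auto
  define i b where "i = r div n" and "b = r mod n"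
  have ib: "i < g" "b < n" "r = i * n + b"
    using r by (auto simp: i_def b_def div_less_of_mult mod_less_of_mult)
  have "(block_row g n X * R) $$ (a, r) = (\<Sum>k<g * n. block_row g n X $$ (a, k) * R $$ (k, r))"
    using a r R by (simp add: mat_mult_index_sum del: index_mult_mat)
  also have "\<dots> = (\<Sum>j<g. \<Sum>c<n. (X ! j) $$ (a, c) * R $$ (j * n + c, i * n + b))"
    unfolding sum_lessThan_mult using a ib by (intro sum.cong refl) (simp add: block_row_index)
  also have "\<dots> = block_row g n (row_times_block g n X R) $$ (a, r)"
    using a ib by (simp add: block_row_index row_times_block_index[OF X])
  finally show "block_row g n (row_times_block g n X R) $$ (a, r) = (block_row g n X * R) $$ (a, r)"
    by simp
qed (use R in auto)

text \<open>The origin of the formula is (J_k \<otimes> Y_k)(J_j \<otimes> X_j) = J_k J_j \<otimes>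
  Y_k X_j. Expanding J_k J_j in J and collecting the coefficient of J_s gives component s.\<close>

definition convexotonic_prod :: "nat \<Rightarrow> mtuple \<Rightarrow> mtuple \<Rightarrow> mtuple \<Rightarrow> mtuple" where
  "convexotonic_prod n \<Xi> Y X = map (\<lambda>s. mat n n (\<lambda>(a, b).
     \<Sum>k<length \<Xi>. \<Sum>j<length \<Xi>. (\<Xi> ! j) $$ (k, s) * (\<Sum>c<n. (Y ! k) $$ (a, c) * (X ! j) $$ (c, b))))
     [0..<length \<Xi>]"

lemma convexotonic_prod_tuple: "convexotonic_prod n \<Xi> Y X \<in> mat_tuples (length \<Xi>) n"
  unfolding convexotonic_prod_def by (rule mat_tuples_map_upt) simp

text \<open>On coordinate rows \<open>\<Xi> ! j\<close> acts as right multiplication by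
  \<open>J ! j\<close>, so the pencil of \<Xi> at X is right multiplication by X in the convexotonic
  product.\<close>

lemma block_row_convexotonic_prod:
  assumes \<Xi>: "\<Xi> \<in> mat_tuples g g" and X: "X \<in> mat_tuples g n"
  shows "block_row g n (convexotonic_prod n \<Xi> Y X) = block_row g n Y * lin_pencil g n \<Xi> X"
proof (rule eq_matI)
  fix a r
  assume "a < dim_row (block_row g n Y * lin_pencil g n \<Xi> X)"
    "r < dim_col (block_row g n Y * lin_pencil g n \<Xi> X)"
  then have a: "a < n" and r: "r < g * n" by auto
  define s b where "s = r div n" and "b = r mod n"
  have sb: "s < g" "b < n" "r = s * n + b"
    using r by (auto simp: s_def b_def div_less_of_mult mod_less_of_mult)
  have [simp]: "length \<Xi> = g" using mat_tuplesD[OF \<Xi>] by simp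
  have "(block_row g n Y * lin_pencil g n \<Xi> X) $$ (a, r)
      = (\<Sum>k<g * n. block_row g n Y $$ (a, k) * lin_pencil g n \<Xi> X $$ (k, r))"
    using a r by (simp add: mat_mult_index_sum del: index_mult_mat)
  also have "\<dots> = (\<Sum>k<g. \<Sum>c<n. (Y ! k) $$ (a, c) * (\<Sum>j<g. (\<Xi> ! j) $$ (k, s) * (X ! j) $$ (c, b)))"
    unfolding sum_lessThan_mult using a sb
    by (intro sum.cong refl) (simp add: block_row_index lin_pencil_index'[OF \<Xi> X])
  also have "\<dots> = (\<Sum>k<g. \<Sum>j<g. \<Sum>c<n. (\<Xi> ! j) $$ (k, s) * ((Y ! k) $$ (a, c) * (X ! j) $$ (c, b)))"
    unfolding sum_distrib_left by (rule sum.cong[OF refl], subst sum.swap) (simp add: mult_ac)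
  also have "\<dots> = block_row g n (convexotonic_prod n \<Xi> Y X) $$ (a, r)"
    using a sb by (simp add: block_row_index convexotonic_prod_def sum_distrib_left)
  finally show "block_row g n (convexotonic_prod n \<Xi> Y X) $$ (a, r)
      = (block_row g n Y * lin_pencil g n \<Xi> X) $$ (a, r)" by simp
qed auto

text \<open>Identifies the tuple \<open>Y\<close> with \<open>\<Sum>\<^sub>k J\<^sub>k \<otimes> Y\<^sub>k\<close>: the convexotonic product is the
  multiplication of the algebra \<open>span J \<otimes> M\<^sub>n(\<complex>)\<close>.\<close>

lemma lin_pencil_convexotonic_prod:
  assumes J: "J \<in> mat_tuples g d" and \<Xi>: "\<Xi> \<in> mat_tuples g g"
    and J_mult: "\<And>j k. j < g \<Longrightarrow> k < g \<Longrightarrow>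
      J ! k * J ! j = lin_comb d (\<lambda>s. (\<Xi> ! j) $$ (k, s)) J"
    and Y: "Y \<in> mat_tuples g n" and X: "X \<in> mat_tuples g n"
  shows "lin_pencil d n J (convexotonic_prod n \<Xi> Y X) = lin_pencil d n J Y * lin_pencil d n J X"
proof (rule eq_matI)
  fix r q
  assume "r < dim_row (lin_pencil d n J Y * lin_pencil d n J X)"
    "q < dim_col (lin_pencil d n J Y * lin_pencil d n J X)"
  then have r: "r < d * n" and q: "q < d * n" by auto
  define i a where "i = r div n" and "a = r mod n"
  define l b where "l = q div n" and "b = q mod n"
  have ia: "i < d" "a < n" "r = i * n + a"
    using r by (auto simp: i_def a_def div_less_of_mult mod_less_of_mult)
  have lb: "l < d" "b < n" "q = l * n + b"
    using q by (auto simp: l_def b_def div_less_of_mult mod_less_of_mult)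
  have len: "length \<Xi> = g" "length J = g" using mat_tuplesD[OF \<Xi>] mat_tuplesD[OF J] by auto
  have swap: "(\<Sum>k<g. \<Sum>j<g. (\<Sum>s<g. x k j s * y s) * P k j)
      = (\<Sum>s<g. y s * (\<Sum>k<g. \<Sum>j<g. x k j s * P k j))" for x y and P :: "nat \<Rightarrow> nat \<Rightarrow> complex"
  proof -
    have "(\<Sum>s<g. y s * (\<Sum>k<g. \<Sum>j<g. x k j s * P k j))
        = (\<Sum>k<g. \<Sum>s<g. \<Sum>j<g. y s * (x k j s * P k j))"
      unfolding sum_distrib_left by (rule sum.swap)
    also have "\<dots> = (\<Sum>k<g. \<Sum>j<g. \<Sum>s<g. y s * (x k j s * P k j))"
      by (rule sum.cong[OF refl], rule sum.swap)
    also have "\<dots> = (\<Sum>k<g. \<Sum>j<g. (\<Sum>s<g. x k j s * y s) * P k j)"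
      by (simp add: sum_distrib_right sum_distrib_left mult_ac)
    finally show ?thesis by simp
  qed
  \<comment> \<open>Entry (i, l) of the structure equation. Around it there is only rearrangement of
    finite sums.\<close>
  have JJ: "(\<Sum>m<d. (J ! k) $$ (i, m) * (J ! j) $$ (m, l)) = (\<Sum>s<g. (\<Xi> ! j) $$ (k, s) * (J ! s) $$ (i, l))"
    if "k < g" "j < g" for k j
  proof -
    have "(J ! k * J ! j) $$ (i, l) = (\<Sum>s<g. (\<Xi> ! j) $$ (k, s) * (J ! s) $$ (i, l))"
      using J_mult[OF that(2,1)] ia lb by (simp add: lin_comb_def len)
    then show ?thesis
      using ia lb that mat_tuplesD[OF J] by (simp add: mat_mult_index_sum del: index_mult_mat)
  qed
  have "(lin_pencil d n J Y * lin_pencil d n J X) $$ (r, q)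
      = (\<Sum>k<d * n. lin_pencil d n J Y $$ (r, k) * lin_pencil d n J X $$ (k, q))"
    using r q by (simp add: mat_mult_index_sum del: index_mult_mat)
  also have "\<dots> = (\<Sum>m<d. \<Sum>c<n. (\<Sum>k<g. (J ! k) $$ (i, m) * (Y ! k) $$ (a, c)) *
      (\<Sum>j<g. (J ! j) $$ (m, l) * (X ! j) $$ (c, b)))"
    unfolding sum_lessThan_mult using ia lb
    by (intro sum.cong refl) (simp add: lin_pencil_index'[OF J X] lin_pencil_index'[OF J Y])
  also have "\<dots> = (\<Sum>m<d. \<Sum>k<g. \<Sum>j<g. \<Sum>c<n.
      ((J ! k) $$ (i, m) * (J ! j) $$ (m, l)) * ((Y ! k) $$ (a, c) * (X ! j) $$ (c, b)))"
    unfolding sum_product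
    by (rule sum.cong[OF refl], subst sum.swap, rule sum.cong[OF refl], subst sum.swap)
      (simp add: mult_ac)
  also have "\<dots> = (\<Sum>k<g. \<Sum>j<g. (\<Sum>m<d. (J ! k) $$ (i, m) * (J ! j) $$ (m, l)) *
      (\<Sum>c<n. (Y ! k) $$ (a, c) * (X ! j) $$ (c, b)))"
    unfolding sum_product
    by (subst sum.swap, rule sum.cong[OF refl], subst sum.swap) simp
  also have "\<dots> = (\<Sum>k<g. \<Sum>j<g. (\<Sum>s<g. (\<Xi> ! j) $$ (k, s) * (J ! s) $$ (i, l)) *
      (\<Sum>c<n. (Y ! k) $$ (a, c) * (X ! j) $$ (c, b)))"
    by (intro sum.cong refl) (simp add: JJ)
  also have "\<dots> = (\<Sum>s<g. (J ! s) $$ (i, l) * (\<Sum>k<g. \<Sum>j<g. (\<Xi> ! j) $$ (k, s) *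
      (\<Sum>c<n. (Y ! k) $$ (a, c) * (X ! j) $$ (c, b))))"
    by (rule swap)
  also have "\<dots> = lin_pencil d n J (convexotonic_prod n \<Xi> Y X) $$ (r, q)"
    using ia lb convexotonic_prod_tuple[of n \<Xi> Y X]
    by (simp add: lin_pencil_index'[OF J] len convexotonic_prod_def)
  finally show "lin_pencil d n J (convexotonic_prod n \<Xi> Y X) $$ (r, q)
      = (lin_pencil d n J Y * lin_pencil d n J X) $$ (r, q)" by simp
qed auto

text \<open>For fixed (a, b), the entries of the pencil at position (a, b) of all blocks form the
  scalar combination of J with coefficients \<open>(X ! j) $$ (a, b)\<close>. Thus independence over
  scalars extends to matrix coefficients.\<close>

lemma lin_pencil_eq_0:
  assumes J: "J \<in> mat_tuples g d" and indep: "lin_indep_tuple d J"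
    and X: "X \<in> mat_tuples g n" and 0: "lin_pencil d n J X = 0\<^sub>m (d * n) (d * n)"
  shows "\<forall>j<g. X ! j = 0\<^sub>m n n"
proof (intro allI impI eq_matI)
  fix j a b assume j: "j < g" and "a < dim_row (0\<^sub>m n n)" "b < dim_col (0\<^sub>m n n)"
  then have ab: "a < n" "b < n" by auto
  have "lin_comb d (\<lambda>j. (X ! j) $$ (a, b)) J = 0\<^sub>m d d"
  proof (rule eq_matI)
    fix i l assume "i < dim_row (0\<^sub>m d d)" "l < dim_col (0\<^sub>m d d)"
    then have il: "i < d" "l < d" by auto
    have "lin_pencil d n J X $$ (i * n + a, l * n + b) = 0"
      using 0 il ab by (simp add: mult_add_less)
    then show "lin_comb d (\<lambda>j. (X ! j) $$ (a, b)) J $$ (i, l) = 0\<^sub>m d d $$ (i, l)"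
      using il ab mat_tuplesD[OF J] by (simp add: lin_pencil_index'[OF J X] lin_comb_def mult.commute)
  qed (auto simp: lin_comb_def)
  then show "(X ! j) $$ (a, b) = 0\<^sub>m n n $$ (a, b)"
    using indep j ab mat_tuplesD[OF J] by (auto simp: lin_indep_tuple_def)
qed (use mat_tuplesD[OF X] in auto)

subsection \<open>The graph of the convexotonic map\<close>

lemma adj_mat_inverse:
  assumes A: "(A :: complex mat) \<in> carrier_mat n n" and det: "Determinant.det A \<noteq> 0"
  defines "B \<equiv> (1 / Determinant.det A) \<cdot>\<^sub>m adj_mat A"
  shows "B \<in> carrier_mat n n" "A * B = 1\<^sub>m n" "B * A = 1\<^sub>m n"
proof -
  have 1: "(1 / Determinant.det A) \<cdot>\<^sub>m (Determinant.det A \<cdot>\<^sub>m 1\<^sub>m n) = 1\<^sub>m n"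
    using det by (intro eq_matI) auto
  show "B \<in> carrier_mat n n" using adj_mat(1)[OF A] by (simp add: B_def)
  show "A * B = 1\<^sub>m n"
    unfolding B_def mult_smult_distrib[OF A adj_mat(1)[OF A]] adj_mat(2)[OF A] by (rule 1)
  show "B * A = 1\<^sub>m n"
    unfolding B_def mult_smult_assoc_mat[OF adj_mat(1)[OF A] A] adj_mat(3)[OF A] by (rule 1)
qed

lemma det_nonzero_obtain_inverse:
  assumes A: "(A :: complex mat) \<in> carrier_mat n n" and "Determinant.det A \<noteq> 0"
  obtains B where "B \<in> carrier_mat n n" "A * B = 1\<^sub>m n" "B * A = 1\<^sub>m n"
  using adj_mat_inverse[OF assms] by (rule that)

lemma left_inverse_det_nonzero:
  assumes "(A :: complex mat) \<in> carrier_mat n n" "B \<in> carrier_mat n n" "B * A = 1\<^sub>m n"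
  shows "Determinant.det A \<noteq> 0"
proof
  assume "Determinant.det A = 0"
  moreover have "Determinant.det B * Determinant.det A = 1"
    using Determinant.det_mult[OF assms(2,1)] assms(3) by simp
  ultimately show False by simp
qed

lemma invertible_mat_iff_det_complex:
  assumes A: "(A :: complex mat) \<in> carrier_mat n n"
  shows "invertible_mat A \<longleftrightarrow> Determinant.det A \<noteq> 0"
proof
  assume "invertible_mat A"
  then obtain B where B: "A * B = 1\<^sub>m n" "B * A = 1\<^sub>m (dim_row B)"
    using A by (auto simp: invertible_mat_def inverts_mat_def)
  have "dim_col (A * B) = n" "dim_col (B * A) = dim_row B" using B by simp_all
  then have "B \<in> carrier_mat n n" using A by auto
  then show "Determinant.det A \<noteq> 0" using A B left_inverse_det_nonzero by auto
next
  assume "Determinant.det A \<noteq> 0"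
  then obtain B where "B \<in> carrier_mat n n" "A * B = 1\<^sub>m n" "B * A = 1\<^sub>m n"
    using det_nonzero_obtain_inverse[OF A] by blast
  then show "invertible_mat A"
    using A by (auto simp: invertible_mat_def inverts_mat_def intro!: exI[of _ B])
qed

text \<open>Gauss-Jordan elimination does not show how the inverse depends on the entries.
  Uniqueness of inverses replaces it by the adjugate formula, whose entries are rational functions;
  analyticity rests on this.\<close>

lemma the_mat_inverse_eq_adj:
  assumes A: "(A :: complex mat) \<in> carrier_mat n n" and det: "Determinant.det A \<noteq> 0"
  shows "the (mat_inverse A) = (1 / Determinant.det A) \<cdot>\<^sub>m adj_mat A"
proof -
  let ?B = "(1 / Determinant.det A) \<cdot>\<^sub>m adj_mat A"
  note B = adj_mat_inverse(1)[OF A det] and AB = adj_mat_inverse(2)[OF A det]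
    and BA = adj_mat_inverse(3)[OF A det]
  have "A \<in> Units (ring_mat TYPE(complex) n ())"
    using A B AB BA unfolding Units_def ring_mat_def by auto
  then obtain C where C: "mat_inverse A = Some C"
    using mat_inverse(1)[OF A, of "()"] by (cases "mat_inverse A") auto
  then have C': "C * A = 1\<^sub>m n" "C \<in> carrier_mat n n" using mat_inverse(2)[OF A C] by auto
  have "C = C * (A * ?B)" using C' AB by simp
  also have "\<dots> = C * A * ?B" using assoc_mult_mat[OF C'(2) A B] by simp
  also have "\<dots> = ?B" unfolding C'(1) by (rule left_mult_one_mat[OF B])
  finally show ?thesis using C by simp
qed

text \<open>The null vector is taken on the left because block rows multiply \<open>M\<close> from
  the left.\<close>

lemma det_zero_left_kernel:
  assumes A: "(A :: complex mat) \<in> carrier_mat n n" and "Determinant.det A = 0"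
  obtains v where "v \<in> carrier_vec n" "v \<noteq> 0\<^sub>v n" "\<And>j. j < n \<Longrightarrow> (\<Sum>i<n. v $ i * A $$ (i, j)) = 0"
proof -
  have "Determinant.det (transpose_mat A) = 0" using assms by (simp add: Determinant.det_transpose[OF A])
  then obtain v where v: "v \<in> carrier_vec n" "v \<noteq> 0\<^sub>v n" "transpose_mat A *\<^sub>v v = 0\<^sub>v n"
    using det_0_iff_vec_prod_zero_field[of "transpose_mat A" n] A by auto
  have "(\<Sum>i<n. v $ i * A $$ (i, j)) = 0" if j: "j < n" for j
  proof -
    have "(transpose_mat A *\<^sub>v v) $ j = (\<Sum>i<n. v $ i * A $$ (i, j))"
      using j A v(1) by (simp add: scalar_prod_def lessThan_atLeast0 mult.commute)
    then show ?thesis using v(3) j by simp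
  qed
  then show ?thesis using v(1,2) that by blast
qed

text \<open>A sign parameter lets one proof serve q (\<sigma> = 1) and p (\<sigma> = -1), and makes
  passing to the inverse map the change of \<sigma> to its negative.\<close>

definition convexotonic :: "complex \<Rightarrow> mtuple \<Rightarrow> free_map" where
  "convexotonic \<sigma> \<Xi> n X =
     (let g = length \<Xi>; M = 1\<^sub>m (g * n) + \<sigma> \<cdot>\<^sub>m lin_pencil g n \<Xi> X in
      if X \<in> mat_tuples g n \<and> invertible_mat M
      then Some (row_times_block g n X (the (mat_inverse M))) else None)"

lemma convexotonic_q_eq: "convexotonic_q = convexotonic 1"
proof (intro ext)
  fix \<Xi> n X
  have "1 \<cdot>\<^sub>m lin_pencil (length \<Xi>) n \<Xi> X = lin_pencil (length \<Xi>) n \<Xi> X"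
    by (intro eq_matI) auto
  then show "convexotonic_q \<Xi> n X = convexotonic 1 \<Xi> n X"
    by (simp add: convexotonic_q_def convexotonic_def Let_def)
qed

lemma convexotonic_p_eq: "convexotonic_p = convexotonic (- 1)"
proof (intro ext)
  fix \<Xi> n X
  have "1\<^sub>m (length \<Xi> * n) - lin_pencil (length \<Xi>) n \<Xi> X =
      1\<^sub>m (length \<Xi> * n) + (- 1) \<cdot>\<^sub>m lin_pencil (length \<Xi>) n \<Xi> X"
    by (intro eq_matI) auto
  then show "convexotonic_p \<Xi> n X = convexotonic (- 1) \<Xi> n X"
    by (simp add: convexotonic_p_def convexotonic_def Let_def)
qed

section \<open>The algebra spanned by J, seen on coordinate rows and on pencils\<close>

locale convexotonic_algebra =
  fixes g d :: nat and J \<Xi> :: mtuple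
  assumes J: "J \<in> mat_tuples g d"
    and indep: "lin_indep_tuple d J"
    and \<Xi>: "\<Xi> \<in> mat_tuples g g"
    and J_mult: "\<And>j k. j < g \<Longrightarrow> k < g \<Longrightarrow>
      J ! k * J ! j = lin_comb d (\<lambda>s. (\<Xi> ! j) $$ (k, s)) J"
begin

abbreviation L :: "nat \<Rightarrow> mtuple \<Rightarrow> complex mat" where
  "L n X \<equiv> lin_pencil d n J X"

text \<open>\<open>M\<close> decides the domain of the map; \<open>N\<close>, defined next, is the
  matrix that the norm conditions of the two sets control.\<close>

abbreviation M :: "complex \<Rightarrow> nat \<Rightarrow> mtuple \<Rightarrow> complex mat" where
  "M \<sigma> n X \<equiv> 1\<^sub>m (g * n) + \<sigma> \<cdot>\<^sub>m lin_pencil g n \<Xi> X"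

abbreviation N :: "complex \<Rightarrow> nat \<Rightarrow> mtuple \<Rightarrow> complex mat" where
  "N \<sigma> n X \<equiv> 1\<^sub>m (d * n) + \<sigma> \<cdot>\<^sub>m L n X"

lemma length_\<Xi> [simp]: "length \<Xi> = g"
  using \<Xi> by (rule mat_tuplesD)

lemma length_J [simp]: "length J = g"
  using J by (rule mat_tuplesD)

lemma M_carrier: "M \<sigma> n X \<in> carrier_mat (g * n) (g * n)"
  by (simp add: lin_pencil_carrier)

lemma N_carrier: "N \<sigma> n X \<in> carrier_mat (d * n) (d * n)"
  by (simp add: lin_pencil_carrier)

lemma dom_convexotonic:
  "X \<in> dom (convexotonic \<sigma> \<Xi> n) \<longleftrightarrow> X \<in> mat_tuples g n \<and> Determinant.det (M \<sigma> n X) \<noteq> 0"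
  by (auto simp: convexotonic_def Let_def invertible_mat_iff_det_complex[OF M_carrier]
      split: if_splits)

text \<open>The product Y (1 + \<sigma> X) in the algebra with a unit adjoined. It is the link
  between the two sizes: \<open>block_row_twist\<close> represents it by right multiplication with
  \<open>M\<close>, \<open>L_twist\<close> by right multiplication with \<open>N\<close>.\<close>

definition twist :: "complex \<Rightarrow> nat \<Rightarrow> mtuple \<Rightarrow> mtuple \<Rightarrow> mtuple" where
  "twist \<sigma> n Y X = map (\<lambda>s. Y ! s + \<sigma> \<cdot>\<^sub>m convexotonic_prod n \<Xi> Y X ! s) [0..<g]"

lemma twist_tuple: "Y \<in> mat_tuples g n \<Longrightarrow> twist \<sigma> n Y X \<in> mat_tuples g n"
  unfolding twist_def using convexotonic_prod_tuple[of n \<Xi> Y X]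
  by (intro mat_tuples_map_upt) (auto simp: mat_tuplesD)

lemma twist_index:
  assumes "Y \<in> mat_tuples g n" "s < g" "a < n" "b < n"
  shows "(twist \<sigma> n Y X ! s) $$ (a, b) = (Y ! s) $$ (a, b) + \<sigma> * (convexotonic_prod n \<Xi> Y X ! s) $$ (a, b)"
  using assms convexotonic_prod_tuple[of n \<Xi> Y X] by (simp add: twist_def mat_tuplesD)

lemma block_row_twist:
  assumes Y: "Y \<in> mat_tuples g n" and X: "X \<in> mat_tuples g n"
  shows "block_row g n (twist \<sigma> n Y X) = block_row g n Y * M \<sigma> n X"
proof -
  have "block_row g n Y * M \<sigma> n X = block_row g n Y + \<sigma> \<cdot>\<^sub>m block_row g n (convexotonic_prod n \<Xi> Y X)"
    using block_row_convexotonic_prod[OF \<Xi> X, of Y] lin_pencil_carrier[of g n \<Xi> X]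
      block_row_carrier[of g n Y]
    by (simp add: mult_add_distrib_mat[OF block_row_carrier one_carrier_mat smult_carrier_mat[OF lin_pencil_carrier]]
        mult_smult_distrib[OF block_row_carrier lin_pencil_carrier])
  also have "\<dots> = block_row g n (twist \<sigma> n Y X)"
  proof (rule eq_matI)
    fix a r assume "a < dim_row (block_row g n (twist \<sigma> n Y X))" "r < dim_col (block_row g n (twist \<sigma> n Y X))"
    then have a: "a < n" and r: "r < g * n" by auto
    show "(block_row g n Y + \<sigma> \<cdot>\<^sub>m block_row g n (convexotonic_prod n \<Xi> Y X)) $$ (a, r)
        = block_row g n (twist \<sigma> n Y X) $$ (a, r)"
      using a r by (simp add: block_row_def twist_index[OF Y] div_less_of_mult mod_less_of_mult)
  qed auto
  finally show ?thesis by simp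
qed

lemma L_twist:
  assumes Y: "Y \<in> mat_tuples g n" and X: "X \<in> mat_tuples g n"
  shows "L n (twist \<sigma> n Y X) = L n Y * N \<sigma> n X"
proof -
  have P: "convexotonic_prod n \<Xi> Y X \<in> mat_tuples g n"
    using convexotonic_prod_tuple[of n \<Xi> Y X] by simp
  have "L n Y * N \<sigma> n X = L n Y + \<sigma> \<cdot>\<^sub>m L n (convexotonic_prod n \<Xi> Y X)"
    using lin_pencil_convexotonic_prod[OF J \<Xi> J_mult Y X] lin_pencil_carrier[of d n J Y]
    by (simp add: mult_add_distrib_mat[OF lin_pencil_carrier one_carrier_mat smult_carrier_mat[OF lin_pencil_carrier]]
        mult_smult_distrib[OF lin_pencil_carrier lin_pencil_carrier])
  also have "\<dots> = L n (twist \<sigma> n Y X)"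
  proof (rule eq_matI)
    fix a r assume "a < dim_row (L n (twist \<sigma> n Y X))" "r < dim_col (L n (twist \<sigma> n Y X))"
    moreover from this have "0 < n" by (cases n) auto
    ultimately show "(L n Y + \<sigma> \<cdot>\<^sub>m L n (convexotonic_prod n \<Xi> Y X)) $$ (a, r) = L n (twist \<sigma> n Y X) $$ (a, r)"
      by (simp add: lin_pencil_index[OF J P] lin_pencil_index[OF J Y] lin_pencil_index[OF J twist_tuple[OF Y]]
          twist_index[OF Y] mod_less_of_mult sum_distrib_left sum.distrib distrib_left mult_ac)
  qed auto
  finally show ?thesis by simp
qed

lemma L_eq_0: "X \<in> mat_tuples g n \<Longrightarrow> L n X = 0\<^sub>m (d * n) (d * n) \<Longrightarrow> j < g \<Longrightarrow> X ! j = 0\<^sub>m n n"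
  using lin_pencil_eq_0[OF J indep] by blast

lemma L_inj:
  assumes X: "X \<in> mat_tuples g n" and Y: "Y \<in> mat_tuples g n" and eq: "L n X = L n Y"
  shows "X = Y"
proof -
  define Z where "Z = map (\<lambda>s. X ! s - Y ! s) [0..<g]"
  have Z: "Z \<in> mat_tuples g n"
    unfolding Z_def using X Y by (intro mat_tuples_map_upt) (auto simp: mat_tuplesD)
  have "L n Z = 0\<^sub>m (d * n) (d * n)"
  proof (rule eq_matI)
    fix r c assume "r < dim_row (0\<^sub>m (d * n) (d * n))" "c < dim_col (0\<^sub>m (d * n) (d * n))"
    then have rc: "r < d * n" "c < d * n" "0 < n" by (auto intro: gr0I)
    have Z_index: "(Z ! j) $$ (a, b) = (X ! j) $$ (a, b) - (Y ! j) $$ (a, b)"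
      if "j < g" "a < n" "b < n" for j a b
      using that mat_tuplesD[OF Y] by (simp add: Z_def)
    have "L n Z $$ (r, c) = L n X $$ (r, c) - L n Y $$ (r, c)"
      using rc
      by (simp add: lin_pencil_index[OF J X] lin_pencil_index[OF J Y] lin_pencil_index[OF J Z]
          Z_index sum_subtractf right_diff_distrib)
    then show "L n Z $$ (r, c) = 0\<^sub>m (d * n) (d * n) $$ (r, c)" using eq rc by simp
  qed auto
  note Z0 = L_eq_0[OF Z this]
  show ?thesis
  proof (rule mat_tuples_eqI[OF X Y])
    fix k assume "k \<in> coords g n"
    then obtain i a b where k: "k = (i, a, b)" "i < g" "a < n" "b < n" by (auto simp: coords_def)
    have "(Z ! i) $$ (a, b) = 0" using Z0 k by simp
    then show "coord X k = coord Y k"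
      using k mat_tuplesD[OF X] mat_tuplesD[OF Y] by (simp add: Z_def coord_def)
  qed
qed

text \<open>A left null vector of \<open>M\<close> is turned into a tuple Y with Y (1 + \<sigma> X)
  = 0. On pencils this says \<open>L n Y * N \<sigma> n X\<close> vanishes, so \<open>L n Y\<close>
  = 0 by invertibility of \<open>N\<close>, and independence of J gives Y = 0.\<close>

lemma det_M_nonzero:
  assumes n: "n > 0" and X: "X \<in> mat_tuples g n" and N: "Determinant.det (N \<sigma> n X) \<noteq> 0"
  shows "Determinant.det (M \<sigma> n X) \<noteq> 0"
proof
  assume "Determinant.det (M \<sigma> n X) = 0"
  then obtain v where v: "v \<in> carrier_vec (g * n)" "v \<noteq> 0\<^sub>v (g * n)"
      "\<And>j. j < g * n \<Longrightarrow> (\<Sum>i<g * n. v $ i * M \<sigma> n X $$ (i, j)) = 0"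
    using det_zero_left_kernel[OF M_carrier] by blast
  \<comment> \<open>Every one of the n rows of \<open>block_row g n Y\<close> is v; since n > 0, row
    0 returns v at the end.\<close>
  define Y where "Y = map (\<lambda>k. mat n n (\<lambda>(a, b). v $ (k * n + b))) [0..<g]"
  have Y: "Y \<in> mat_tuples g n" unfolding Y_def by (rule mat_tuples_map_upt) simp
  have row: "block_row g n Y $$ (a, r) = v $ r" if "a < n" "r < g * n" for a r
    using that by (simp add: block_row_def Y_def div_less_of_mult mod_less_of_mult)
  have "block_row g n (twist \<sigma> n Y X) = 0\<^sub>m n (g * n)"
    unfolding block_row_twist[OF Y X]
  proof (rule eq_matI)
    fix a r assume "a < dim_row (0\<^sub>m n (g * n))" "r < dim_col (0\<^sub>m n (g * n))"
    then have a: "a < n" and r: "r < g * n" by auto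
    have "(block_row g n Y * M \<sigma> n X) $$ (a, r) = (\<Sum>i<g * n. v $ i * M \<sigma> n X $$ (i, r))"
      using a r M_carrier[of n \<sigma> X]
      by (subst mat_mult_index_sum) (auto simp: row simp del: index_add_mat(1) intro!: sum.cong)
    then show "(block_row g n Y * M \<sigma> n X) $$ (a, r) = 0\<^sub>m n (g * n) $$ (a, r)"
      using v(3)[OF r] a r by simp
  qed auto
  moreover have "block_row g n (map (\<lambda>_. 0\<^sub>m n n) [0..<g]) = 0\<^sub>m n (g * n)"
    by (intro eq_matI) (auto simp: block_row_def div_less_of_mult mod_less_of_mult)
  ultimately have "twist \<sigma> n Y X = map (\<lambda>_. 0\<^sub>m n n) [0..<g]"
    by (intro block_row_inj[OF twist_tuple[OF Y]] mat_tuples_map_upt) auto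
  moreover have "L n (map (\<lambda>_. 0\<^sub>m n n) [0..<g]) = 0\<^sub>m (d * n) (d * n)"
    by (intro eq_matI) (auto simp: lin_pencil_index[OF J mat_tuples_map_upt] mod_less_of_mult)
  ultimately have LN: "L n Y * N \<sigma> n X = 0\<^sub>m (d * n) (d * n)" by (simp add: L_twist[OF Y X, symmetric])
  obtain B where B: "B \<in> carrier_mat (d * n) (d * n)" "N \<sigma> n X * B = 1\<^sub>m (d * n)"
    using det_nonzero_obtain_inverse[OF N_carrier N] by blast
  have "L n Y = L n Y * (N \<sigma> n X * B)" using B lin_pencil_carrier[of d n J Y] by simp
  also have "\<dots> = L n Y * N \<sigma> n X * B"
    by (rule assoc_mult_mat[OF lin_pencil_carrier N_carrier B(1), symmetric])
  also have "\<dots> = 0\<^sub>m (d * n) (d * n)" using LN B by simp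
  finally have Y0: "\<And>k. k < g \<Longrightarrow> Y ! k = 0\<^sub>m n n" using L_eq_0[OF Y] by blast
  have "v = 0\<^sub>v (g * n)"
  proof (rule eq_vecI)
    fix r assume "r < dim_vec (0\<^sub>v (g * n))"
    then have r: "r < g * n" by simp
    have "block_row g n Y $$ (0, r) = 0"
      using r n by (simp add: block_row_def Y0 div_less_of_mult mod_less_of_mult)
    then show "v $ r = 0\<^sub>v (g * n) $ r" using row[OF n r] r by simp
  qed (use v in auto)
  then show False using v by simp
qed

text \<open>The defining formula freed of its inverse. Algebraic arguments use only this equation;
  the explicit inverse returns for differentiability and continuity.\<close>

lemma convexotonic_block_row:
  assumes "convexotonic \<sigma> \<Xi> n X = Some Y"
  shows "Y \<in> mat_tuples g n" "block_row g n Y * M \<sigma> n X = block_row g n X"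
proof -
  have X: "X \<in> mat_tuples g n" and det: "Determinant.det (M \<sigma> n X) \<noteq> 0"
    using assms dom_convexotonic[of X \<sigma> n] by auto
  define R where "R = the (mat_inverse (M \<sigma> n X))"
  have R: "R = (1 / Determinant.det (M \<sigma> n X)) \<cdot>\<^sub>m adj_mat (M \<sigma> n X)"
    unfolding R_def by (rule the_mat_inverse_eq_adj[OF M_carrier det])
  have Rc: "R \<in> carrier_mat (g * n) (g * n)" using adj_mat[OF M_carrier] R by simp
  have RM: "R * M \<sigma> n X = 1\<^sub>m (g * n)"
    unfolding R by (rule adj_mat_inverse(3)[OF M_carrier det])
  have Y: "Y = row_times_block g n X R"
    using assms by (auto simp: convexotonic_def Let_def R_def split: if_splits)
  then show "Y \<in> mat_tuples g n" by (simp add: row_times_block_tuple)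
  have "block_row g n Y * M \<sigma> n X = block_row g n X * R * M \<sigma> n X"
    using block_row_row_times_block[OF X Rc] Y by simp
  also have "\<dots> = block_row g n X * (R * M \<sigma> n X)"
    by (rule assoc_mult_mat[OF block_row_carrier Rc M_carrier])
  also have "\<dots> = block_row g n X" using RM right_mult_one_mat[OF block_row_carrier] by simp
  finally show "block_row g n Y * M \<sigma> n X = block_row g n X" .
qed

text \<open>The graph of the convexotonic map in terms of \<open>\<Lambda>\<^sub>J\<close>. For \<open>\<sigma> = 1\<close> and
  \<open>\<sigma> = -1\<close> the roles of \<open>X\<close> and \<open>Y\<close> are exchanged, so \<open>q\<close> and \<open>p\<close> are inverse.\<close>

lemma convexotonic_graph:
  assumes "convexotonic \<sigma> \<Xi> n X = Some Y"
  shows "N (- \<sigma>) n Y * N \<sigma> n X = 1\<^sub>m (d * n)"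
proof -
  note Y = convexotonic_block_row[OF assms]
  have X: "X \<in> mat_tuples g n" using assms dom_convexotonic[of X \<sigma> n] by auto
  \<comment> \<open>In the algebra the value of the map solves Y (1 + \<sigma> X) = X; on pencils
    this becomes \<open>LX\<close>, from which the claim follows by subtracting \<sigma>
    \<open>L n X\<close> from \<open>N \<sigma> n X\<close>.\<close>
  have "twist \<sigma> n Y X = X"
    by (rule block_row_inj[OF twist_tuple[OF Y(1)] X]) (simp only: block_row_twist[OF Y(1) X] Y(2))
  then have LX: "L n Y * N \<sigma> n X = L n X" using L_twist[OF Y(1) X, of \<sigma>] by simp
  have "N (- \<sigma>) n Y * N \<sigma> n X = 1\<^sub>m (d * n) * N \<sigma> n X + (- \<sigma> \<cdot>\<^sub>m L n Y) * N \<sigma> n X"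
    by (rule add_mult_distrib_mat[OF one_carrier_mat smult_carrier_mat[OF lin_pencil_carrier] N_carrier])
  also have "\<dots> = N \<sigma> n X + (- \<sigma>) \<cdot>\<^sub>m L n X"
    using mult_smult_assoc_mat[OF lin_pencil_carrier N_carrier, of "- \<sigma>" n J Y \<sigma> X] LX
      left_mult_one_mat[OF N_carrier] by simp
  also have "\<dots> = 1\<^sub>m (d * n)" by (intro eq_matI) auto
  finally show ?thesis .
qed

text \<open>The graph equation determines the value: it makes \<open>N \<sigma> n X\<close>
  invertible, so X lies in the domain, and it pins down \<open>N (- \<sigma>) n Y\<close> as the
  inverse. As \<sigma> is nonzero this fixes \<open>L n Y\<close>, hence Y.\<close>

lemma convexotonic_eqI:
  assumes n: "n > 0" and \<sigma>: "\<sigma> \<noteq> 0" and X: "X \<in> mat_tuples g n" and Y: "Y \<in> mat_tuples g n"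
    and 1: "N (- \<sigma>) n Y * N \<sigma> n X = 1\<^sub>m (d * n)"
  shows "convexotonic \<sigma> \<Xi> n X = Some Y"
proof -
  have "Determinant.det (N \<sigma> n X) \<noteq> 0" by (rule left_inverse_det_nonzero[OF N_carrier N_carrier 1])
  from det_M_nonzero[OF n X this] have "X \<in> dom (convexotonic \<sigma> \<Xi> n)" using X dom_convexotonic by blast
  then obtain Z where Z: "convexotonic \<sigma> \<Xi> n X = Some Z" by auto
  have right: "N \<sigma> n X * N (- \<sigma>) n Z = 1\<^sub>m (d * n)"
    by (rule mat_mult_left_right_inverse[OF N_carrier N_carrier convexotonic_graph[OF Z]])
  have "N (- \<sigma>) n Y = N (- \<sigma>) n Y * (N \<sigma> n X * N (- \<sigma>) n Z)"
    unfolding right by (rule right_mult_one_mat[OF N_carrier, symmetric])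
  also have "\<dots> = N (- \<sigma>) n Y * N \<sigma> n X * N (- \<sigma>) n Z"
    by (rule assoc_mult_mat[OF N_carrier N_carrier N_carrier, symmetric])
  also have "\<dots> = N (- \<sigma>) n Z" unfolding 1 by (rule left_mult_one_mat[OF N_carrier])
  finally have NYZ: "N (- \<sigma>) n Y = N (- \<sigma>) n Z" .
  have "L n Y = L n Z"
  proof (rule eq_matI)
    fix r c assume rc: "r < dim_row (L n Z)" "c < dim_col (L n Z)"
    have "N (- \<sigma>) n Y $$ (r, c) = N (- \<sigma>) n Z $$ (r, c)" using NYZ by simp
    then show "L n Y $$ (r, c) = L n Z $$ (r, c)" using rc \<sigma> by simp
  qed auto
  then have "Y = Z" by (rule L_inj[OF Y convexotonic_block_row(1)[OF Z]])
  then show ?thesis using Z by simp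
qed

text \<open>A one-sided inverse of a square matrix is two-sided, so the two factors of the graph
  equation commute; swapped, they form the graph equation for the opposite sign.\<close>

lemma convexotonic_inverse:
  assumes n: "n > 0" and \<sigma>: "\<sigma> \<noteq> 0" and XY: "convexotonic \<sigma> \<Xi> n X = Some Y"
  shows "convexotonic (- \<sigma>) \<Xi> n Y = Some X"
proof (rule convexotonic_eqI[OF n])
  show "X \<in> mat_tuples g n" using XY dom_convexotonic[of X \<sigma> n] by auto
  show "N (- (- \<sigma>)) n X * N (- \<sigma>) n Y = 1\<^sub>m (d * n)"
    using mat_mult_left_right_inverse[OF N_carrier N_carrier convexotonic_graph[OF XY]] by simp
qed (use \<sigma> convexotonic_block_row(1)[OF XY] in auto)

end

subsection \<open>Differentiability and continuity of functions of a tuple\<close>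

lemma topspace_tuple_topology [simp]: "topspace (tuple_topology g n) = mat_tuples g n"
  by (simp add: tuple_topology_def Metric_space.topspace_mtopology[OF Metric_space_mat_tuples])

text \<open>Openness is restated with the filter \<open>nhdsin\<close>, so that the
  \<open>tendsto\<close> rules for scalar functions can be used to prove sets open and maps
  continuous.\<close>

lemma openin_tuple_topology_iff_eventually:
  "openin (tuple_topology g n) U \<longleftrightarrow> U \<subseteq> mat_tuples g n \<and>
     (\<forall>X\<in>U. eventually (\<lambda>Y. Y \<in> U) (nhdsin (tuple_topology g n) X))"
proof
  assume "openin (tuple_topology g n) U"
  then show "U \<subseteq> mat_tuples g n \<and> (\<forall>X\<in>U. eventually (\<lambda>Y. Y \<in> U) (nhdsin (tuple_topology g n) X))"
    using openin_subset[of "tuple_topology g n" U] by (auto simp: eventually_nhdsin)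
next
  assume U: "U \<subseteq> mat_tuples g n \<and> (\<forall>X\<in>U. eventually (\<lambda>Y. Y \<in> U) (nhdsin (tuple_topology g n) X))"
  show "openin (tuple_topology g n) U"
    using U by (subst openin_subopen) (fastforce simp: eventually_nhdsin)
qed

lemma eventually_nhdsin_tuple:
  assumes "X \<in> mat_tuples g n"
  shows "eventually P (nhdsin (tuple_topology g n) X) \<longleftrightarrow>
    (\<exists>\<delta>>0. \<forall>Y\<in>mat_tuples g n. tuple_dist g n X Y < \<delta> \<longrightarrow> P Y)"
proof
  interpret Metric_space "mat_tuples g n" "tuple_dist g n" by (rule Metric_space_mat_tuples)
  {
    assume "eventually P (nhdsin (tuple_topology g n) X)"
    then obtain S where "openin mtopology S" "X \<in> S" "\<forall>Y\<in>S. P Y"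
      using assms by (auto simp: eventually_nhdsin tuple_topology_def)
    moreover from this obtain \<delta> where "\<delta> > 0" "mball X \<delta> \<subseteq> S"
      unfolding openin_mtopology by blast
    ultimately show "\<exists>\<delta>>0. \<forall>Y\<in>mat_tuples g n. tuple_dist g n X Y < \<delta> \<longrightarrow> P Y"
      using assms by (intro exI[of _ \<delta>]) (auto simp: subset_iff)
  next
    assume "\<exists>\<delta>>0. \<forall>Y\<in>mat_tuples g n. tuple_dist g n X Y < \<delta> \<longrightarrow> P Y"
    then obtain \<delta> where \<delta>: "\<delta> > 0" "\<forall>Y\<in>mat_tuples g n. tuple_dist g n X Y < \<delta> \<longrightarrow> P Y" by blast
    have "openin mtopology (mball X \<delta>)" "X \<in> mball X \<delta>" using \<delta>(1) assms by auto
    then show "eventually P (nhdsin (tuple_topology g n) X)"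
      using \<delta>(2) unfolding eventually_nhdsin tuple_topology_def by (metis in_mball)
  }
qed

lemma eventually_nhdsin_tuple_in:
  "X \<in> mat_tuples g n \<Longrightarrow> eventually (\<lambda>Y. Y \<in> mat_tuples g n) (nhdsin (tuple_topology g n) X)"
  by (subst eventually_nhdsin_tuple) (auto intro: exI[of _ 1])

lemma eventually_nhdsin_self:
  "eventually P (nhdsin (tuple_topology g n) X) \<Longrightarrow> X \<in> mat_tuples g n \<Longrightarrow> P X"
  by (auto simp: eventually_nhdsin)

lemma finite_coords [simp]: "finite (coords g n)"
  by (simp add: coords_def)

lemma coord_diff_le_tuple_dist:
  "k \<in> coords g n \<Longrightarrow> cmod (coord Y k - coord X k) \<le> tuple_dist g n X Y"
  unfolding tuple_dist_def
  using member_le_L2_set[of "coords g n" k "\<lambda>k. cmod (coord X k - coord Y k)"]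
  by (simp add: norm_minus_commute)

lemma tendsto_coord:
  assumes "X \<in> mat_tuples g n" "k \<in> coords g n"
  shows "((\<lambda>Y. coord Y k) \<longlongrightarrow> coord X k) (nhdsin (tuple_topology g n) X)"
  unfolding tendsto_iff dist_norm eventually_nhdsin_tuple[OF assms(1)]
  using coord_diff_le_tuple_dist[OF assms(2)] by (meson order_le_less_trans)

lemma tuple_dist_tendsto_0:
  assumes "\<And>k. k \<in> coords g m \<Longrightarrow> ((\<lambda>Y. coord (f Y) k) \<longlongrightarrow> coord (f X) k) F"
  shows "((\<lambda>Y. tuple_dist g m (f X) (f Y)) \<longlongrightarrow> 0) F"
proof -
  have "((\<lambda>Y. tuple_dist g m (f X) (f Y)) \<longlongrightarrow> sqrt (\<Sum>k\<in>coords g m. (cmod (coord (f X) k - coord (f X) k))\<^sup>2)) F"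
    unfolding tuple_dist_def L2_set_def by (intro tendsto_intros assms)
  then show ?thesis by simp
qed

text \<open>In Caratheodory's form differentiability passes to sums, products and inverses without error
  estimates.\<close>

definition caratheodory_at :: "nat \<Rightarrow> nat \<Rightarrow> (mtuple \<Rightarrow> complex) \<Rightarrow> mtuple \<Rightarrow> bool" where
  "caratheodory_at g n \<phi> X \<longleftrightarrow> (\<exists>E.
     (\<forall>\<^sub>F Y in nhdsin (tuple_topology g n) X.
        \<phi> Y - \<phi> X = (\<Sum>k\<in>coords g n. E k Y * (coord Y k - coord X k))) \<and>
     (\<forall>k\<in>coords g n. (E k \<longlongrightarrow> E k X) (nhdsin (tuple_topology g n) X)))"

lemma caratheodory_at_tendsto:
  assumes X: "X \<in> mat_tuples g n" and \<phi>: "caratheodory_at g n \<phi> X"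
  shows "(\<phi> \<longlongrightarrow> \<phi> X) (nhdsin (tuple_topology g n) X)"
proof -
  let ?F = "nhdsin (tuple_topology g n) X"
  obtain E where E: "\<forall>\<^sub>F Y in ?F. \<phi> Y - \<phi> X = (\<Sum>k\<in>coords g n. E k Y * (coord Y k - coord X k))"
      "\<And>k. k \<in> coords g n \<Longrightarrow> (E k \<longlongrightarrow> E k X) ?F"
    using \<phi> by (auto simp: caratheodory_at_def)
  have "((\<lambda>Y. \<phi> X + (\<Sum>k\<in>coords g n. E k Y * (coord Y k - coord X k))) \<longlongrightarrow>
      \<phi> X + (\<Sum>k\<in>coords g n. E k X * (coord X k - coord X k))) ?F"
    by (intro tendsto_intros E(2) tendsto_coord[OF X])
  then have "((\<lambda>Y. \<phi> X + (\<Sum>k\<in>coords g n. E k Y * (coord Y k - coord X k))) \<longlongrightarrow> \<phi> X) ?F"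
    by simp
  then show ?thesis
    by (rule Lim_transform_eventually) (use E(1) in \<open>auto elim!: eventually_mono simp: algebra_simps\<close>)
qed

text \<open>With derivative \<open>E k X\<close>, the remainder is the sum of
  \<open>E k Y - E k X\<close> times coordinate increments. Each increment is at most the distance,
  and the other factors tend to 0.\<close>

lemma caratheodory_at_imp_complex_diff_at:
  assumes X: "X \<in> mat_tuples g n" and \<phi>: "caratheodory_at g n \<phi> X"
  shows "complex_diff_at g n \<phi> X"
proof -
  let ?F = "nhdsin (tuple_topology g n) X"
  obtain E where E: "\<forall>\<^sub>F Y in ?F. \<phi> Y - \<phi> X = (\<Sum>k\<in>coords g n. E k Y * (coord Y k - coord X k))"
      "\<And>k. k \<in> coords g n \<Longrightarrow> (E k \<longlongrightarrow> E k X) ?F"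
    using \<phi> by (auto simp: caratheodory_at_def)
  have "((\<lambda>Y. \<Sum>k\<in>coords g n. cmod (E k Y - E k X)) \<longlongrightarrow> (\<Sum>k\<in>coords g n. cmod (E k X - E k X))) ?F"
    by (intro tendsto_intros E(2))
  then have lim: "((\<lambda>Y. \<Sum>k\<in>coords g n. cmod (E k Y - E k X)) \<longlongrightarrow> 0) ?F" by simp
  show ?thesis
    unfolding complex_diff_at_def
  proof (intro exI[of _ "\<lambda>k. E k X"] allI impI)
    fix \<epsilon> :: real assume "\<epsilon> > 0"
    have "\<forall>\<^sub>F Y in ?F. cmod (\<phi> Y - \<phi> X - (\<Sum>k\<in>coords g n. E k X * (coord Y k - coord X k)))
        \<le> \<epsilon> * tuple_dist g n X Y"
      using E(1) order_tendstoD(2)[OF lim \<open>\<epsilon> > 0\<close>]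
    proof eventually_elim
      case (elim Y)
      have "\<phi> Y - \<phi> X - (\<Sum>k\<in>coords g n. E k X * (coord Y k - coord X k))
          = (\<Sum>k\<in>coords g n. (E k Y - E k X) * (coord Y k - coord X k))"
        by (simp add: elim(1) sum_subtractf left_diff_distrib)
      also have "cmod \<dots> \<le> (\<Sum>k\<in>coords g n. cmod (E k Y - E k X) * tuple_dist g n X Y)"
        by (rule sum_norm_le) (simp add: norm_mult mult_left_mono coord_diff_le_tuple_dist)
      also have "\<dots> = (\<Sum>k\<in>coords g n. cmod (E k Y - E k X)) * tuple_dist g n X Y"
        by (simp add: sum_distrib_right)
      also have "\<dots> \<le> \<epsilon> * tuple_dist g n X Y"
        using elim(2) by (intro mult_right_mono) (auto simp: tuple_dist_def)
      finally show ?case .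
    qed
    then show "\<exists>\<delta>>0. \<forall>Y\<in>mat_tuples g n. tuple_dist g n X Y < \<delta> \<longrightarrow>
        cmod (\<phi> Y - \<phi> X - (\<Sum>k\<in>coords g n. E k X * (coord Y k - coord X k))) \<le> \<epsilon> * tuple_dist g n X Y"
      by (simp add: eventually_nhdsin_tuple[OF X])
  qed
qed

text \<open>The filter \<open>nhdsin\<close> is not punctured, so eventual equality includes
  equality at X, which the difference quotient identity requires.\<close>

lemma caratheodory_at_cong:
  assumes X: "X \<in> mat_tuples g n" and eq: "\<forall>\<^sub>F Y in nhdsin (tuple_topology g n) X. \<phi> Y = \<psi> Y"
    and \<phi>: "caratheodory_at g n \<phi> X"
  shows "caratheodory_at g n \<psi> X"
proof -
  let ?F = "nhdsin (tuple_topology g n) X"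
  obtain E where E: "\<forall>\<^sub>F Y in ?F. \<phi> Y - \<phi> X = (\<Sum>k\<in>coords g n. E k Y * (coord Y k - coord X k))"
      "\<forall>k\<in>coords g n. (E k \<longlongrightarrow> E k X) ?F"
    using \<phi> by (auto simp: caratheodory_at_def)
  have "\<forall>\<^sub>F Y in ?F. \<psi> Y - \<psi> X = (\<Sum>k\<in>coords g n. E k Y * (coord Y k - coord X k))"
    using E(1) eq eventually_nhdsin_self[OF eq X] by (auto elim: eventually_elim2)
  then show ?thesis using E(2) by (auto simp: caratheodory_at_def)
qed

lemma caratheodory_at_const: "caratheodory_at g n (\<lambda>_. c) X"
  unfolding caratheodory_at_def by (intro exI[of _ "\<lambda>_ _. 0"]) auto

lemma caratheodory_at_coord:
  assumes "k \<in> coords g n"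
  shows "caratheodory_at g n (\<lambda>Y. coord Y k) X"
  unfolding caratheodory_at_def
  using assms by (intro exI[of _ "\<lambda>l _. if l = k then 1 else 0"]) 
    (auto simp: if_distrib[of "\<lambda>x. x * _"] cong: if_cong)

lemma caratheodory_at_add:
  assumes "caratheodory_at g n \<phi> X" "caratheodory_at g n \<psi> X"
  shows "caratheodory_at g n (\<lambda>Y. \<phi> Y + \<psi> Y) X"
proof -
  let ?F = "nhdsin (tuple_topology g n) X"
  obtain D E where D: "\<forall>\<^sub>F Y in ?F. \<phi> Y - \<phi> X = (\<Sum>k\<in>coords g n. D k Y * (coord Y k - coord X k))"
      "\<And>k. k \<in> coords g n \<Longrightarrow> (D k \<longlongrightarrow> D k X) ?F"
    and E: "\<forall>\<^sub>F Y in ?F. \<psi> Y - \<psi> X = (\<Sum>k\<in>coords g n. E k Y * (coord Y k - coord X k))"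
      "\<And>k. k \<in> coords g n \<Longrightarrow> (E k \<longlongrightarrow> E k X) ?F"
    using assms by (auto simp: caratheodory_at_def)
  show ?thesis unfolding caratheodory_at_def
  proof (intro exI[of _ "\<lambda>k Y. D k Y + E k Y"] conjI ballI)
    show "\<forall>\<^sub>F Y in ?F. \<phi> Y + \<psi> Y - (\<phi> X + \<psi> X) =
        (\<Sum>k\<in>coords g n. (D k Y + E k Y) * (coord Y k - coord X k))"
      using D(1) E(1)
    proof eventually_elim
      case (elim Y)
      have "\<phi> Y + \<psi> Y - (\<phi> X + \<psi> X) = (\<phi> Y - \<phi> X) + (\<psi> Y - \<psi> X)" by simp
      then show ?case unfolding elim by (simp add: sum.distrib distrib_right)
    qed
  qed (intro tendsto_intros D(2) E(2))
qed

lemma caratheodory_at_mult: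
  assumes X: "X \<in> mat_tuples g n" and \<phi>: "caratheodory_at g n \<phi> X" and \<psi>: "caratheodory_at g n \<psi> X"
  shows "caratheodory_at g n (\<lambda>Y. \<phi> Y * \<psi> Y) X"
proof -
  let ?F = "nhdsin (tuple_topology g n) X"
  obtain D E where D: "\<forall>\<^sub>F Y in ?F. \<phi> Y - \<phi> X = (\<Sum>k\<in>coords g n. D k Y * (coord Y k - coord X k))"
      "\<And>k. k \<in> coords g n \<Longrightarrow> (D k \<longlongrightarrow> D k X) ?F"
    and E: "\<forall>\<^sub>F Y in ?F. \<psi> Y - \<psi> X = (\<Sum>k\<in>coords g n. E k Y * (coord Y k - coord X k))"
      "\<And>k. k \<in> coords g n \<Longrightarrow> (E k \<longlongrightarrow> E k X) ?F"
    using \<phi> \<psi> by (auto simp: caratheodory_at_def)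
  show ?thesis unfolding caratheodory_at_def
  \<comment> \<open>Keeping one factor at Y and freezing the other at X makes the product rule an
    exact identity; continuity of \<psi> gives the limit of the slopes.\<close>
  proof (intro exI[of _ "\<lambda>k Y. D k Y * \<psi> Y + \<phi> X * E k Y"] conjI ballI)
    show "\<forall>\<^sub>F Y in ?F. \<phi> Y * \<psi> Y - \<phi> X * \<psi> X =
        (\<Sum>k\<in>coords g n. (D k Y * \<psi> Y + \<phi> X * E k Y) * (coord Y k - coord X k))"
      using D(1) E(1)
    proof eventually_elim
      case (elim Y)
      have "\<phi> Y * \<psi> Y - \<phi> X * \<psi> X = (\<phi> Y - \<phi> X) * \<psi> Y + \<phi> X * (\<psi> Y - \<psi> X)"
        by (simp add: algebra_simps)
      then show ?case
        unfolding elim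
        by (simp add: sum.distrib distrib_right distrib_left sum_distrib_left sum_distrib_right mult_ac)
    qed
  qed (intro tendsto_intros D(2) E(2) caratheodory_at_tendsto[OF X \<psi>])
qed

lemma caratheodory_at_inverse:
  assumes X: "X \<in> mat_tuples g n" and \<phi>: "caratheodory_at g n \<phi> X" and 0: "\<phi> X \<noteq> 0"
  shows "caratheodory_at g n (\<lambda>Y. inverse (\<phi> Y)) X"
proof -
  let ?F = "nhdsin (tuple_topology g n) X"
  obtain D where D: "\<forall>\<^sub>F Y in ?F. \<phi> Y - \<phi> X = (\<Sum>k\<in>coords g n. D k Y * (coord Y k - coord X k))"
      "\<And>k. k \<in> coords g n \<Longrightarrow> (D k \<longlongrightarrow> D k X) ?F"
    using \<phi> by (auto simp: caratheodory_at_def)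
  note lim = caratheodory_at_tendsto[OF X \<phi>]
  show ?thesis unfolding caratheodory_at_def
  proof (intro exI[of _ "\<lambda>k Y. - (inverse (\<phi> Y) * D k Y * inverse (\<phi> X))"] conjI ballI)
    show "\<forall>\<^sub>F Y in ?F. inverse (\<phi> Y) - inverse (\<phi> X) =
        (\<Sum>k\<in>coords g n. - (inverse (\<phi> Y) * D k Y * inverse (\<phi> X)) * (coord Y k - coord X k))"
      using D(1) tendsto_imp_eventually_ne[OF lim 0]
    proof eventually_elim
      case (elim Y)
      have "inverse (\<phi> Y) - inverse (\<phi> X) = - (inverse (\<phi> Y) * (\<phi> Y - \<phi> X) * inverse (\<phi> X))"
        using inverse_diff_inverse[OF elim(2) 0] by simp
      then show ?case
        unfolding elim(1) by (simp add: sum_negf sum_distrib_left sum_distrib_right mult_ac)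
    qed
  qed (intro tendsto_intros D(2) lim 0)
qed

lemma caratheodory_at_sum:
  assumes "\<And>i. i \<in> I \<Longrightarrow> caratheodory_at g n (\<phi> i) X"
  shows "caratheodory_at g n (\<lambda>Y. \<Sum>i\<in>I. \<phi> i Y) X"
  using assms
  by (induction I rule: infinite_finite_induct) (auto intro: caratheodory_at_const caratheodory_at_add)

lemma caratheodory_at_prod:
  assumes "X \<in> mat_tuples g n" "\<And>i. i \<in> I \<Longrightarrow> caratheodory_at g n (\<phi> i) X"
  shows "caratheodory_at g n (\<lambda>Y. \<Prod>i\<in>I. \<phi> i Y) X"
  using assms
  by (induction I rule: infinite_finite_induct) (auto intro: caratheodory_at_const caratheodory_at_mult)

text \<open>By the Leibniz formula the determinant is a polynomial in the entries.\<close>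

lemma caratheodory_at_det:
  assumes X: "X \<in> mat_tuples g n" and A: "\<And>Y. A Y \<in> carrier_mat m m"
    and ent: "\<And>i j. i < m \<Longrightarrow> j < m \<Longrightarrow> caratheodory_at g n (\<lambda>Y. A Y $$ (i, j)) X"
  shows "caratheodory_at g n (\<lambda>Y. Determinant.det (A Y)) X"
  unfolding det_def'[OF A]
  by (intro caratheodory_at_sum caratheodory_at_mult[OF X] caratheodory_at_const caratheodory_at_prod[OF X] ent)
    (auto simp: permutes_in_image)

lemma caratheodory_at_cofactor:
  assumes X: "X \<in> mat_tuples g n" and A: "\<And>Y. A Y \<in> carrier_mat m m"
    and ent: "\<And>i j. i < m \<Longrightarrow> j < m \<Longrightarrow> caratheodory_at g n (\<lambda>Y. A Y $$ (i, j)) X"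
    and ij: "i < m" "j < m"
  shows "caratheodory_at g n (\<lambda>Y. cofactor (A Y) i j) X"
proof -
  have "caratheodory_at g n (\<lambda>Y. Determinant.det (mat_delete (A Y) i j)) X"
  proof (rule caratheodory_at_det[OF X])
    show "mat_delete (A Y) i j \<in> carrier_mat (m - 1) (m - 1)" for Y
      using A[of Y] by (simp add: mat_delete_def carrier_matD)
    fix k l assume kl: "k < m - 1" "l < m - 1"
    have "A Y $$ (if k < i then k else Suc k, if l < j then l else Suc l) = mat_delete (A Y) i j $$ (k, l)" for Y
      using A[of Y] kl by (simp add: mat_delete_def carrier_matD)
    moreover have "(if k < i then k else Suc k) < m" "(if l < j then l else Suc l) < m"
      using kl by auto
    ultimately show "caratheodory_at g n (\<lambda>Y. mat_delete (A Y) i j $$ (k, l)) X"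
      using ent[of "if k < i then k else Suc k" "if l < j then l else Suc l"] by (simp only:)
  qed
  then show ?thesis
    unfolding cofactor_def by (intro caratheodory_at_mult[OF X] caratheodory_at_const)
qed

lemma continuous_map_tupleI:
  assumes D: "openin (tuple_topology g n) D" and f: "\<And>X. X \<in> D \<Longrightarrow> f X \<in> mat_tuples g n"
    and lim: "\<And>X k. X \<in> D \<Longrightarrow> k \<in> coords g n \<Longrightarrow>
      ((\<lambda>Y. coord (f Y) k) \<longlongrightarrow> coord (f X) k) (nhdsin (tuple_topology g n) X)"
  shows "continuous_map (subtopology (tuple_topology g n) D) (tuple_topology g n) f"
proof -
  have D_sub: "D \<subseteq> mat_tuples g n" using openin_subset[OF D] by simp
  have "openin (tuple_topology g n) {X \<in> D. f X \<in> U}" if U: "openin (tuple_topology g n) U" for U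
    unfolding openin_tuple_topology_iff_eventually
  proof (intro conjI ballI)
    show "{X \<in> D. f X \<in> U} \<subseteq> mat_tuples g n" using D_sub by auto
    fix X assume "X \<in> {X \<in> D. f X \<in> U}"
    then have X: "X \<in> D" "f X \<in> U" by auto
    then have "eventually (\<lambda>Y. Y \<in> U) (nhdsin (tuple_topology g n) (f X))"
      using openin_tuple_topology_iff_eventually[THEN iffD1, OF U] by simp
    then obtain \<delta> where \<delta>: "\<delta> > 0" "\<forall>Y\<in>mat_tuples g n. tuple_dist g n (f X) Y < \<delta> \<longrightarrow> Y \<in> U"
      using eventually_nhdsin_tuple[OF f[OF X(1)], of "\<lambda>Y. Y \<in> U"] by auto
    have "((\<lambda>Y. tuple_dist g n (f X) (f Y)) \<longlongrightarrow> 0) (nhdsin (tuple_topology g n) X)"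
      using X D_sub by (intro tuple_dist_tendsto_0 lim) auto
    from order_tendstoD(2)[OF this \<delta>(1)]
    have "\<forall>\<^sub>F Y in nhdsin (tuple_topology g n) X. tuple_dist g n (f X) (f Y) < \<delta>" .
    moreover have "\<forall>\<^sub>F Y in nhdsin (tuple_topology g n) X. Y \<in> D"
      using openin_tuple_topology_iff_eventually[THEN iffD1, OF D] X by simp
    ultimately show "\<forall>\<^sub>F Y in nhdsin (tuple_topology g n) X. Y \<in> {X \<in> D. f X \<in> U}"
      by eventually_elim (use f \<delta>(2) in auto)
  qed
  then show ?thesis
    using D D_sub f
    by (auto simp: continuous_map_def openin_open_subtopology Int_absorb1 Int_absorb2)
qed

text \<open>The inclusions of the two summands intertwine the direct sum with X and with Y. Applying
  f to these relations determines the first n and the last m columns of its value at the direct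
  sum.\<close>

lemma respects_direct_sumsI:
  assumes f: "free_maps_into S (mat_tuples g) f" and S: "\<And>n. n > 0 \<Longrightarrow> S n \<subseteq> mat_tuples g n"
    and int: "respects_intertwining g S f"
  shows "respects_direct_sums S f"
  unfolding respects_direct_sums_def
proof (intro allI impI ballI)
  fix n m X Y
  assume n: "0 < n" and m: "0 < m" and X: "X \<in> S n" and Y: "Y \<in> S m" and W: "direct_sum X Y \<in> S (n + m)"
  define F where "F = the (f (n + m) (direct_sum X Y))"
  have into: "the (f l Z) \<in> mat_tuples g l" if "0 < l" "Z \<in> S l" for l Z
    using f that unfolding free_maps_into_def by (metis option.sel)
  have FT: "F \<in> mat_tuples g (n + m)" and fX: "the (f n X) \<in> mat_tuples g n"
    and fY: "the (f m Y) \<in> mat_tuples g m"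
    using n m X Y W by (auto simp: F_def intro!: into)
  have XT: "X \<in> mat_tuples g n" and YT: "Y \<in> mat_tuples g m" using S n m X Y by auto
  \<comment> \<open>The coordinate inclusions of the summands: multiplication by \<open>T1\<close>
    or \<open>T2\<close> on the right selects columns, on the left it pads with zero rows.\<close>
  define T1 :: "complex mat" where "T1 = mat (n + m) n (\<lambda>(i, j). if i = j then 1 else 0)"
  define T2 :: "complex mat" where "T2 = mat (n + m) m (\<lambda>(i, j). if i = j + n then 1 else 0)"
  have mult1: "(A * T1) $$ (a, b) = A $$ (a, b)"
    if "A \<in> carrier_mat (n + m) (n + m)" "a < n + m" "b < n" for A a b
    using that by (simp add: T1_def mat_mult_index_sum if_distrib[of "\<lambda>x. _ * x"] del: index_mult_mat cong: if_cong)
  have mult2: "(A * T2) $$ (a, b) = A $$ (a, b + n)"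
    if "A \<in> carrier_mat (n + m) (n + m)" "a < n + m" "b < m" for A a b
    using that by (simp add: T2_def mat_mult_index_sum if_distrib[of "\<lambda>x. _ * x"] del: index_mult_mat cong: if_cong)
  have T1_mult: "(T1 * A) $$ (a, b) = (if a < n then A $$ (a, b) else 0)"
    if "A \<in> carrier_mat n n" "a < n + m" "b < n" for A a b
    using that by (auto simp: T1_def mat_mult_index_sum if_distrib[of "\<lambda>x. x * _"] simp del: index_mult_mat cong: if_cong)
  have T2_mult: "(T2 * A) $$ (a, b) = (if a < n then 0 else A $$ (a - n, b))"
    if "A \<in> carrier_mat m m" "a < n + m" "b < m" for A a b
  proof -
    \<comment> \<open>The guard \<open>a \<ge> n\<close> is essential: truncated subtraction sends
      every a < n to 0, which would otherwise match k = 0.\<close>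
    have "(T2 * A) $$ (a, b) = (\<Sum>k<m. if k = a - n \<and> a \<ge> n then A $$ (a - n, b) else 0)"
      using that by (auto simp: T2_def mat_mult_index_sum simp del: index_mult_mat intro!: sum.cong)
    then show ?thesis using that by (cases "a < n") auto
  qed
  have diag: "diag_block_mat [A, B] $$ (a, b) = (if a < n then if b < n then A $$ (a, b) else 0
      else if b < n then 0 else B $$ (a - n, b - n))" "diag_block_mat [A, B] \<in> carrier_mat (n + m) (n + m)"
    if "A \<in> carrier_mat n n" "B \<in> carrier_mat m m" "a < n + m" "b < n + m" for A B a b
    using that by (auto simp: Let_def)
  have nth_sum: "direct_sum U V ! i = diag_block_mat [U ! i, V ! i]"
    if "U \<in> mat_tuples g n" "V \<in> mat_tuples g m" "i < g" for U V i
    using that mat_tuplesD(1) by (simp add: direct_sum_def)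
  have sumT: "direct_sum U V \<in> mat_tuples g (n + m)"
    if "U \<in> mat_tuples g n" "V \<in> mat_tuples g m" for U V
  proof -
    have "length (direct_sum U V) = g" using that mat_tuplesD(1) by (simp add: direct_sum_def)
    moreover have "direct_sum U V ! i \<in> carrier_mat (n + m) (n + m)" if "i < g" for i
      using diag(2)[of "U ! i" "V ! i" 0 0] nth_sum[OF \<open>U \<in> _\<close> \<open>V \<in> _\<close> that]
        \<open>U \<in> _\<close> \<open>V \<in> _\<close> that n mat_tuplesD(2) by simp
    ultimately show ?thesis by (auto simp: mat_tuples_def in_set_conv_nth)
  qed
  have c1: "T1 \<in> carrier_mat (n + m) n" and c2: "T2 \<in> carrier_mat (n + m) m" by (auto simp: T1_def T2_def)
  have eq1: "direct_sum U V ! i * T1 = T1 * U ! i" and eq2: "direct_sum U V ! i * T2 = T2 * V ! i"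
    if U: "U \<in> mat_tuples g n" and V: "V \<in> mat_tuples g m" and i: "i < g" for U V i
  proof -
    note c = mat_tuplesD(2)[OF U i] mat_tuplesD(2)[OF V i] mat_tuplesD(2)[OF sumT[OF U V] i]
    show "direct_sum U V ! i * T1 = T1 * U ! i"
    proof (rule eq_matI)
      fix a b assume "a < dim_row (T1 * U ! i)" "b < dim_col (T1 * U ! i)"
      then have ab: "a < n + m" "b < n" using c c1 by auto
      show "(direct_sum U V ! i * T1) $$ (a, b) = (T1 * U ! i) $$ (a, b)"
        unfolding mult1[OF c(3) ab] T1_mult[OF c(1) ab]
        unfolding nth_sum[OF U V i] diag(1)[OF c(1,2) ab(1) trans_less_add1[OF ab(2)]]
        using ab by simp
    qed (use c c1 in auto)
    show "direct_sum U V ! i * T2 = T2 * V ! i"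
    proof (rule eq_matI)
      fix a b assume "a < dim_row (T2 * V ! i)" "b < dim_col (T2 * V ! i)"
      then have ab: "a < n + m" "b < m" using c c2 by auto
      then have b': "b + n < n + m" by simp
      show "(direct_sum U V ! i * T2) $$ (a, b) = (T2 * V ! i) $$ (a, b)"
        unfolding mult2[OF c(3) ab] T2_mult[OF c(2) ab]
        unfolding nth_sum[OF U V i] diag(1)[OF c(1,2) ab(1) b']
        using ab by simp
    qed (use c c2 in auto)
  qed
  have "\<forall>i<g. F ! i * T1 = T1 * the (f n X) ! i" "\<forall>i<g. F ! i * T2 = T2 * the (f m Y) ! i"
    unfolding F_def
    using int[unfolded respects_intertwining_def, rule_format, of "n + m" n "direct_sum X Y" X T1]
      int[unfolded respects_intertwining_def, rule_format, of "n + m" m "direct_sum X Y" Y T2]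
      n m X Y W c1 c2 eq1[OF XT YT] eq2[OF XT YT] by simp_all
  note Feq = this
  show "F = direct_sum (the (f n X)) (the (f m Y))"
  proof (rule mat_tuples_eqI[OF FT sumT[OF fX fY]])
    fix k assume "k \<in> coords g (n + m)"
    then obtain i a b where k: "k = (i, a, b)" "i < g" "a < n + m" "b < n + m" by (auto simp: coords_def)
    let ?G = "direct_sum (the (f n X)) (the (f m Y))"
    note cF = mat_tuplesD(2)[OF FT k(2)] and cG = mat_tuplesD(2)[OF sumT[OF fX fY] k(2)]
    have "F ! i $$ (a, b) = ?G ! i $$ (a, b)"
    proof (cases "b < n")
      case True
      have "F ! i * T1 = ?G ! i * T1" using Feq(1) k eq1[OF fX fY] by simp
      then show ?thesis using mult1[OF cF k(3) True] mult1[OF cG k(3) True] by simp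
    next
      case False
      then have b: "b - n < m" "b = (b - n) + n" using k by auto
      have "F ! i * T2 = ?G ! i * T2" using Feq(2) k eq2[OF fX fY] by simp
      then show ?thesis using mult2[OF cF k(3) b(1)] mult2[OF cG k(3) b(1)] b(2) by simp
    qed
    then show "coord F k = coord ?G k" using k by (simp add: coord_def)
  qed
qed

subsection \<open>Analyticity and intertwining\<close>

context convexotonic_algebra
begin

lemma caratheodory_at_M:
  assumes X: "X \<in> mat_tuples g n" and rc: "r < g * n" "c < g * n"
  shows "caratheodory_at g n (\<lambda>Y. M \<sigma> n Y $$ (r, c)) X"
proof -
  have "0 < n" using rc by (auto intro: gr0I)
  then have coords: "(j, r mod n, c mod n) \<in> coords g n" if "j < g" for j
    using that by (simp add: coords_def)
  let ?\<phi> = "\<lambda>Y. 1\<^sub>m (g * n) $$ (r, c) +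
    \<sigma> * (\<Sum>j<g. (\<Xi> ! j) $$ (r div n, c div n) * coord Y (j, r mod n, c mod n))"
  have "caratheodory_at g n ?\<phi> X"
    using coords by (intro caratheodory_at_add caratheodory_at_mult[OF X] caratheodory_at_sum
        caratheodory_at_const caratheodory_at_coord) auto
  \<comment> \<open>The affine formula for the entry is established for Y in
    \<open>mat_tuples g n\<close>; the filter sees only such Y.\<close>
  moreover have "\<forall>\<^sub>F Y in nhdsin (tuple_topology g n) X. ?\<phi> Y = M \<sigma> n Y $$ (r, c)"
    using eventually_nhdsin_tuple_in[OF X]
    by eventually_elim (use rc in \<open>simp add: lin_pencil_index[OF \<Xi>] coord_def\<close>)
  ultimately show ?thesis by (rule caratheodory_at_cong[OF X, rotated])
qed

lemma caratheodory_at_det_M: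
  "X \<in> mat_tuples g n \<Longrightarrow> caratheodory_at g n (\<lambda>Y. Determinant.det (M \<sigma> n Y)) X"
  by (intro caratheodory_at_det[of X g n _ "g * n"] M_carrier caratheodory_at_M)

text \<open>The domain is the set where a continuous determinant does not vanish.\<close>

lemma openin_dom_convexotonic: "openin (tuple_topology g n) (dom (convexotonic \<sigma> \<Xi> n))"
  unfolding openin_tuple_topology_iff_eventually
proof (intro conjI ballI)
  show "dom (convexotonic \<sigma> \<Xi> n) \<subseteq> mat_tuples g n" using dom_convexotonic by blast
  fix X assume "X \<in> dom (convexotonic \<sigma> \<Xi> n)"
  then have X: "X \<in> mat_tuples g n" "Determinant.det (M \<sigma> n X) \<noteq> 0" using dom_convexotonic by blast+
  from eventually_nhdsin_tuple_in[OF X(1)]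
    tendsto_imp_eventually_ne[OF caratheodory_at_tendsto[OF X(1) caratheodory_at_det_M[OF X(1)]] X(2)]
  show "\<forall>\<^sub>F Y in nhdsin (tuple_topology g n) X. Y \<in> dom (convexotonic \<sigma> \<Xi> n)"
    by eventually_elim (simp only: dom_convexotonic simp_thms)
qed

text \<open>Cramer's rule presents each output coordinate as a rational function of the input. The
  adjugate is the transposed cofactor matrix, hence the exchanged indices.\<close>

lemma coord_convexotonic:
  assumes "X \<in> dom (convexotonic \<sigma> \<Xi> n)" "s < g" "a < n" "b < n"
  shows "coord (the (convexotonic \<sigma> \<Xi> n X)) (s, a, b) =
    (\<Sum>j<g. \<Sum>c<n. coord X (j, a, c) *
      (inverse (Determinant.det (M \<sigma> n X)) * cofactor (M \<sigma> n X) (s * n + b) (j * n + c)))"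
proof -
  have X: "X \<in> mat_tuples g n" and det: "Determinant.det (M \<sigma> n X) \<noteq> 0"
    using assms(1) dom_convexotonic by blast+
  have the: "the (convexotonic \<sigma> \<Xi> n X) = row_times_block g n X (the (mat_inverse (M \<sigma> n X)))"
    using assms(1) by (auto simp: convexotonic_def Let_def split: if_splits)
  have "the (mat_inverse (M \<sigma> n X)) $$ (j * n + c, s * n + b) =
      inverse (Determinant.det (M \<sigma> n X)) * cofactor (M \<sigma> n X) (s * n + b) (j * n + c)"
    if "j < g" "c < n" for j c
    unfolding the_mat_inverse_eq_adj[OF M_carrier det]
    using that assms mult_add_less by (simp add: adj_mat_def inverse_eq_divide)
  then show ?thesis
    unfolding the coord_def using assms by (simp add: row_times_block_index[OF X])
qed

lemma caratheodory_at_convexotonic: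
  assumes XD: "X \<in> dom (convexotonic \<sigma> \<Xi> n)" and k: "k \<in> coords g n"
  shows "caratheodory_at g n (\<lambda>Y. coord (the (convexotonic \<sigma> \<Xi> n Y)) k) X"
proof -
  have X: "X \<in> mat_tuples g n" and det: "Determinant.det (M \<sigma> n X) \<noteq> 0"
    using XD dom_convexotonic by blast+
  obtain s a b where sab: "k = (s, a, b)" "s < g" "a < n" "b < n" using k by (auto simp: coords_def)
  let ?\<phi> = "\<lambda>Y. \<Sum>j<g. \<Sum>c<n. coord Y (j, a, c) *
      (inverse (Determinant.det (M \<sigma> n Y)) * cofactor (M \<sigma> n Y) (s * n + b) (j * n + c))"
  have "caratheodory_at g n ?\<phi> X"
    using sab
    by (intro caratheodory_at_sum caratheodory_at_mult[OF X] caratheodory_at_coord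
        caratheodory_at_inverse[OF X] caratheodory_at_cofactor[OF X M_carrier]
        caratheodory_at_M[OF X] caratheodory_at_det_M[OF X] det mult_add_less)
      (auto simp: coords_def)
  moreover have "\<forall>\<^sub>F Y in nhdsin (tuple_topology g n) X. ?\<phi> Y = coord (the (convexotonic \<sigma> \<Xi> n Y)) k"
  proof (rule eventually_mono)
    show "\<forall>\<^sub>F Y in nhdsin (tuple_topology g n) X. Y \<in> dom (convexotonic \<sigma> \<Xi> n)"
      using openin_tuple_topology_iff_eventually[THEN iffD1, OF openin_dom_convexotonic] XD by blast
    show "?\<phi> Y = coord (the (convexotonic \<sigma> \<Xi> n Y)) k" if "Y \<in> dom (convexotonic \<sigma> \<Xi> n)" for Y
      unfolding sab(1) by (rule coord_convexotonic[OF that sab(2-4), symmetric])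
  qed
  ultimately show ?thesis by (rule caratheodory_at_cong[OF X, rotated])
qed

text \<open>The open domain of the map serves as the neighbourhood of every point, so S itself need
  not be open; this covers the full spectrahedron and spectraball.\<close>

lemma free_analytic_on_convexotonic:
  assumes "\<And>n. n > 0 \<Longrightarrow> S n \<subseteq> dom (convexotonic \<sigma> \<Xi> n)"
  shows "free_analytic_on g S (convexotonic \<sigma> \<Xi>)"
  unfolding free_analytic_on_def
proof (intro allI impI ballI)
  fix n X assume n: "0 < n" and X: "X \<in> S n"
  show "\<exists>U. openin (tuple_topology g n) U \<and> X \<in> U \<and> U \<subseteq> dom (convexotonic \<sigma> \<Xi> n) \<and>
      (\<forall>Y\<in>U. \<forall>k\<in>coords g n. complex_diff_at g n (\<lambda>Z. coord (the (convexotonic \<sigma> \<Xi> n Z)) k) Y)"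
  proof (intro exI conjI ballI)
    show "openin (tuple_topology g n) (dom (convexotonic \<sigma> \<Xi> n))" by (rule openin_dom_convexotonic)
    show "X \<in> dom (convexotonic \<sigma> \<Xi> n)" using assms[OF n] X by blast
    fix Y k assume Y: "Y \<in> dom (convexotonic \<sigma> \<Xi> n)" and k: "k \<in> coords g n"
    then have "Y \<in> mat_tuples g n" using dom_convexotonic by blast
    then show "complex_diff_at g n (\<lambda>Z. coord (the (convexotonic \<sigma> \<Xi> n Z)) k) Y"
      by (rule caratheodory_at_imp_complex_diff_at[OF _ caratheodory_at_convexotonic[OF Y k]])
  qed simp
qed

lemma convexotonic_in_mat_tuples:
  "X \<in> dom (convexotonic \<sigma> \<Xi> n) \<Longrightarrow> the (convexotonic \<sigma> \<Xi> n X) \<in> mat_tuples g n"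
  using convexotonic_block_row(1) by auto

lemma continuous_map_convexotonic:
  "continuous_map (subtopology (tuple_topology g n) (dom (convexotonic \<sigma> \<Xi> n)))
    (tuple_topology g n) (\<lambda>X. the (convexotonic \<sigma> \<Xi> n X))"
proof (rule continuous_map_tupleI[OF openin_dom_convexotonic convexotonic_in_mat_tuples])
  fix X k assume X: "X \<in> dom (convexotonic \<sigma> \<Xi> n)" and k: "k \<in> coords g n"
  have "X \<in> mat_tuples g n" using X dom_convexotonic by blast
  then show "((\<lambda>Y. coord (the (convexotonic \<sigma> \<Xi> n Y)) k) \<longlongrightarrow> coord (the (convexotonic \<sigma> \<Xi> n X)) k)
      (nhdsin (tuple_topology g n) X)"
    by (rule caratheodory_at_tendsto[OF _ caratheodory_at_convexotonic[OF X k]])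
qed

section \<open>The maps respect intertwining and direct sums\<close>

lemma convexotonic_intertwining:
  assumes XD: "X \<in> dom (convexotonic \<sigma> \<Xi> n)" and YD: "Y \<in> dom (convexotonic \<sigma> \<Xi> m)"
    and T: "T \<in> carrier_mat n m" and XT: "\<And>j. j < g \<Longrightarrow> X ! j * T = T * Y ! j" and i: "i < g"
  shows "the (convexotonic \<sigma> \<Xi> n X) ! i * T = T * the (convexotonic \<sigma> \<Xi> m Y) ! i"
proof -
  have X: "X \<in> mat_tuples g n" and Y: "Y \<in> mat_tuples g m"
    using XD YD dom_convexotonic by blast+
  have detY: "Determinant.det (M \<sigma> m Y) \<noteq> 0" using YD dom_convexotonic by blast
  obtain A where A: "convexotonic \<sigma> \<Xi> n X = Some A" using XD by blast
  obtain B where B: "convexotonic \<sigma> \<Xi> m Y = Some B" using YD by blast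
  note A' = convexotonic_block_row[OF A] and B' = convexotonic_block_row[OF B]
  \<comment> \<open>S is I_g \<otimes> T. It carries the intertwining relation from the components
    to the block row and to \<open>M\<close>; with A and B the values at X and Y, it then remains to
    cancel the invertible \<open>M \<sigma> m Y\<close> from A S M = T B M.\<close>
  define S where "S = mat (g * n) (g * m)
    (\<lambda>(r, c). if r div n = c div m then T $$ (r mod n, c mod m) else 0)"
  have S: "S \<in> carrier_mat (g * n) (g * m)" by (simp add: S_def)
  have S_index: "S $$ (k * n + a, s * m + b) = (if k = s then T $$ (a, b) else 0)"
    if "k < g" "s < g" "a < n" "b < m" for k s a b
    using that mult_add_less by (simp add: S_def)
  have row_S: "(block_row g n Z * S) $$ (a, s * m + b) = (Z ! s * T) $$ (a, b)"
    if "Z \<in> mat_tuples g n" "s < g" "a < n" "b < m" for Z s a b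
  proof -
    have "(block_row g n Z * S) $$ (a, s * m + b) =
        (\<Sum>k<g. \<Sum>c<n. if k = s then (Z ! k) $$ (a, c) * T $$ (c, b) else 0)"
      using that S mult_add_less
      by (auto simp: mat_mult_index_sum sum_lessThan_mult block_row_index S_index simp del: index_mult_mat
          intro!: sum.cong)
    also have "\<dots> = (\<Sum>k<g. if k = s then \<Sum>c<n. (Z ! k) $$ (a, c) * T $$ (c, b) else 0)"
      by (intro sum.cong) auto
    also have "\<dots> = (Z ! s * T) $$ (a, b)"
      using that T mat_tuplesD[OF that(1)] by (simp add: mat_mult_index_sum del: index_mult_mat)
    finally show ?thesis .
  qed
  have T_row: "(T * block_row g m Z) $$ (a, s * m + b) = (T * Z ! s) $$ (a, b)"
    if "Z \<in> mat_tuples g m" "s < g" "a < n" "b < m" for Z s a b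
    using that T mat_tuplesD[OF that(1)] mult_add_less
    by (simp add: mat_mult_index_sum block_row_index del: index_mult_mat)
  have block_eqI: "P = Q" if "P \<in> carrier_mat n (g * m)" "Q \<in> carrier_mat n (g * m)"
    "\<And>a s b. a < n \<Longrightarrow> s < g \<Longrightarrow> b < m \<Longrightarrow> P $$ (a, s * m + b) = Q $$ (a, s * m + b)"
    for P Q :: "complex mat"
  proof (rule eq_matI)
    fix a r assume "a < dim_row Q" "r < dim_col Q"
    then have "a < n" "r < g * m" using that by auto
    then show "P $$ (a, r) = Q $$ (a, r)"
      using that(3)[of a "r div m" "r mod m"] by (simp add: div_less_of_mult mod_less_of_mult)
  qed (use that in auto)
  have XS: "block_row g n X * S = T * block_row g m Y"
    using S T by (intro block_eqI) (auto simp: row_S[OF X] T_row[OF Y] XT simp del: index_mult_mat(1))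
  have LS: "lin_pencil g n \<Xi> X * S = S * lin_pencil g m \<Xi> Y"
  proof (rule eq_matI)
    fix r c assume "r < dim_row (S * lin_pencil g m \<Xi> Y)" "c < dim_col (S * lin_pencil g m \<Xi> Y)"
    then have r: "r < g * n" and c: "c < g * m" using S by auto
    define k a where "k = r div n" and "a = r mod n"
    define s b where "s = c div m" and "b = c mod m"
    have ka: "k < g" "a < n" "r = k * n + a"
      using r by (auto simp: k_def a_def div_less_of_mult mod_less_of_mult)
    have sb: "s < g" "b < m" "c = s * m + b"
      using c by (auto simp: s_def b_def div_less_of_mult mod_less_of_mult)
    have "(lin_pencil g n \<Xi> X * S) $$ (r, c) = (\<Sum>l<g. \<Sum>e<n.
        if l = s then (\<Sum>j<g. (\<Xi> ! j) $$ (k, l) * (X ! j) $$ (a, e)) * T $$ (e, b) else 0)"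
      using r c ka sb S
      by (auto simp: mat_mult_index_sum sum_lessThan_mult lin_pencil_index'[OF \<Xi> X] S_index
          simp del: index_mult_mat intro!: sum.cong)
    also have "\<dots> = (\<Sum>l<g. if l = s then
        \<Sum>e<n. (\<Sum>j<g. (\<Xi> ! j) $$ (k, l) * (X ! j) $$ (a, e)) * T $$ (e, b) else 0)"
      by (intro sum.cong) auto
    also have "\<dots> = (\<Sum>e<n. \<Sum>j<g. (\<Xi> ! j) $$ (k, s) * ((X ! j) $$ (a, e) * T $$ (e, b)))"
      using sb by (simp add: sum_distrib_right mult.assoc)
    also have "\<dots> = (\<Sum>j<g. (\<Xi> ! j) $$ (k, s) * (X ! j * T) $$ (a, b))"
      using ka sb T mat_tuplesD[OF X]
      by (subst sum.swap) (auto simp: mat_mult_index_sum sum_distrib_left simp del: index_mult_mat)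
    also have "\<dots> = (\<Sum>j<g. (\<Xi> ! j) $$ (k, s) * (T * Y ! j) $$ (a, b))"
      by (simp add: XT del: index_mult_mat)
    also have "\<dots> = (\<Sum>e<m. \<Sum>j<g. (\<Xi> ! j) $$ (k, s) * (T $$ (a, e) * (Y ! j) $$ (e, b)))"
      using ka sb T mat_tuplesD[OF Y]
      by (subst sum.swap) (auto simp: mat_mult_index_sum sum_distrib_left simp del: index_mult_mat)
    also have "\<dots> = (\<Sum>l<g. if l = k then
        \<Sum>e<m. T $$ (a, e) * (\<Sum>j<g. (\<Xi> ! j) $$ (l, s) * (Y ! j) $$ (e, b)) else 0)"
      using ka by (simp add: sum_distrib_left mult.left_commute)
    also have "\<dots> = (\<Sum>l<g. \<Sum>e<m. if l = k then
        T $$ (a, e) * (\<Sum>j<g. (\<Xi> ! j) $$ (l, s) * (Y ! j) $$ (e, b)) else 0)"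
      by (intro sum.cong) auto
    also have "\<dots> = (S * lin_pencil g m \<Xi> Y) $$ (r, c)"
      using r c ka sb S
      by (auto simp: mat_mult_index_sum sum_lessThan_mult lin_pencil_index'[OF \<Xi> Y] S_index
          simp del: index_mult_mat intro!: sum.cong)
    finally show "(lin_pencil g n \<Xi> X * S) $$ (r, c) = (S * lin_pencil g m \<Xi> Y) $$ (r, c)" .
  qed (use S in auto)
  have MS: "M \<sigma> n X * S = S * M \<sigma> m Y"
  proof -
    have "M \<sigma> n X * S = 1\<^sub>m (g * n) * S + (\<sigma> \<cdot>\<^sub>m lin_pencil g n \<Xi> X) * S"
      by (rule add_mult_distrib_mat[OF one_carrier_mat smult_carrier_mat[OF lin_pencil_carrier] S])
    also have "\<dots> = S + \<sigma> \<cdot>\<^sub>m (S * lin_pencil g m \<Xi> Y)"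
      unfolding mult_smult_assoc_mat[OF lin_pencil_carrier S] LS left_mult_one_mat[OF S] ..
    also have "\<dots> = S * 1\<^sub>m (g * m) + S * (\<sigma> \<cdot>\<^sub>m lin_pencil g m \<Xi> Y)"
      unfolding mult_smult_distrib[OF S lin_pencil_carrier] right_mult_one_mat[OF S] ..
    also have "\<dots> = S * M \<sigma> m Y"
      by (rule mult_add_distrib_mat[OF S one_carrier_mat smult_carrier_mat[OF lin_pencil_carrier], symmetric])
    finally show ?thesis .
  qed
  have AS: "block_row g n A * S \<in> carrier_mat n (g * m)" and TB: "T * block_row g m B \<in> carrier_mat n (g * m)"
    using mult_carrier_mat[OF block_row_carrier S] mult_carrier_mat[OF T block_row_carrier] by auto
  have "block_row g n A * S * M \<sigma> m Y = block_row g n A * M \<sigma> n X * S"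
    unfolding assoc_mult_mat[OF block_row_carrier S M_carrier]
      assoc_mult_mat[OF block_row_carrier M_carrier S] MS ..
  also have "\<dots> = T * (block_row g m B * M \<sigma> m Y)" unfolding A'(2) XS B'(2) ..
  also have "\<dots> = T * block_row g m B * M \<sigma> m Y"
    by (rule assoc_mult_mat[OF T block_row_carrier M_carrier, symmetric])
  finally have eq: "block_row g n A * S * M \<sigma> m Y = T * block_row g m B * M \<sigma> m Y" .
  obtain R where R: "R \<in> carrier_mat (g * m) (g * m)" "M \<sigma> m Y * R = 1\<^sub>m (g * m)"
    using det_nonzero_obtain_inverse[OF M_carrier detY] by blast
  have "block_row g n A * S = block_row g n A * S * (M \<sigma> m Y * R)"
    unfolding R(2) by (rule right_mult_one_mat[OF AS, symmetric])
  also have "\<dots> = T * block_row g m B * (M \<sigma> m Y * R)"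
    unfolding assoc_mult_mat[OF AS M_carrier R(1), symmetric] eq
    by (rule assoc_mult_mat[OF TB M_carrier R(1)])
  also have "\<dots> = T * block_row g m B"
    unfolding R(2) by (rule right_mult_one_mat[OF TB])
  finally have AB: "block_row g n A * S = T * block_row g m B" .
  have "A ! i * T = T * B ! i"
  proof (rule eq_matI)
    fix a b assume "a < dim_row (T * B ! i)" "b < dim_col (T * B ! i)"
    then have ab: "a < n" "b < m" using T mat_tuplesD[OF B'(1)] i by auto
    show "(A ! i * T) $$ (a, b) = (T * B ! i) $$ (a, b)"
      unfolding row_S[OF A'(1) i ab, symmetric] T_row[OF B'(1) i ab, symmetric] AB ..
  qed (use T mat_tuplesD[OF A'(1)] mat_tuplesD[OF B'(1)] i in auto)
  then show ?thesis using A B by simp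
qed

lemma free_mapping_convexotonic:
  assumes "\<And>n. n > 0 \<Longrightarrow> S n \<subseteq> dom (convexotonic \<sigma> \<Xi> n)"
  shows "free_mapping g S (convexotonic \<sigma> \<Xi>)"
proof -
  have "free_maps_into S (mat_tuples g) (convexotonic \<sigma> \<Xi>)"
    unfolding free_maps_into_def
  proof (intro allI impI ballI)
    fix n X assume "0 < n" "X \<in> S n"
    then obtain Y where "convexotonic \<sigma> \<Xi> n X = Some Y" using assms by blast
    then show "\<exists>Y\<in>mat_tuples g n. convexotonic \<sigma> \<Xi> n X = Some Y"
      using convexotonic_block_row(1) by blast
  qed
  moreover have "S n \<subseteq> mat_tuples g n" if "n > 0" for n using assms[OF that] dom_convexotonic by blast
  moreover have "respects_intertwining g S (convexotonic \<sigma> \<Xi>)"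
    unfolding respects_intertwining_def
  proof (intro allI impI ballI)
    fix n m i X Y and T :: "complex mat"
    assume *: "0 < n" "0 < m" "X \<in> S n" "Y \<in> S m" "T \<in> carrier_mat n m"
      "\<forall>j<g. X ! j * T = T * Y ! j" "i < g"
    show "the (convexotonic \<sigma> \<Xi> n X) ! i * T = T * the (convexotonic \<sigma> \<Xi> m Y) ! i"
      by (rule convexotonic_intertwining) (use * assms in auto)
  qed
  ultimately show ?thesis using respects_direct_sumsI by (simp add: free_mapping_def)
qed

end

subsection \<open>Norm characterisations of spectrahedra and spectraballs\<close>

lemma vnorm_nonneg [simp]: "0 \<le> vnorm v"
  by (simp add: vnorm_def)

lemma vnorm_power2: "(vnorm v)\<^sup>2 = (\<Sum>i<dim_vec v. (cmod (v $ i))\<^sup>2)"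
  by (simp add: vnorm_def L2_set_def sum_nonneg)

lemma vnorm_eq_0_iff: "vnorm v = 0 \<longleftrightarrow> v = 0\<^sub>v (dim_vec v)"
  by (auto simp: vnorm_def L2_set_eq_0_iff vec_eq_iff)

lemma vnorm_smult: "vnorm (c \<cdot>\<^sub>v v) = cmod c * vnorm v"
proof -
  have "vnorm (c \<cdot>\<^sub>v v) = L2_set (\<lambda>i. cmod c * cmod (v $ i)) {..<dim_vec v}"
    unfolding vnorm_def by (rule L2_set_cong) (auto simp: norm_mult)
  then show ?thesis by (simp add: vnorm_def L2_set_right_distrib)
qed

lemma cmod_le_vnorm: "i < dim_vec v \<Longrightarrow> cmod (v $ i) \<le> vnorm v"
  unfolding vnorm_def by (rule member_le_L2_set[of _ i "\<lambda>i. cmod (v $ i)"]) auto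

lemma mult_mat_vec_index_sum:
  assumes "i < dim_row A" "dim_vec v = dim_col A"
  shows "(A *\<^sub>v v) $ i = (\<Sum>k<dim_col A. A $$ (i, k) * v $ k)"
  using assms by (simp add: scalar_prod_def lessThan_atLeast0)

text \<open>The infimum in \<open>op_norm\<close> is itself an admissible constant: every slightly
  larger number exceeds one, and the excess can be made arbitrarily small for each vector.\<close>

lemma op_norm_le_iff:
  assumes c: "0 \<le> c"
  shows "op_norm M \<le> c \<longleftrightarrow> (\<forall>v\<in>carrier_vec (dim_col M). vnorm (M *\<^sub>v v) \<le> c * vnorm v)"
proof
  define C where "C = {c. 0 \<le> c \<and> (\<forall>v\<in>carrier_vec (dim_col M). vnorm (M *\<^sub>v v) \<le> c * vnorm v)}"
  have op: "op_norm M = Inf C" by (simp add: op_norm_def C_def)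
  have bdd: "bdd_below C" by (auto simp: C_def intro: bdd_belowI)
  {
    assume "\<forall>v\<in>carrier_vec (dim_col M). vnorm (M *\<^sub>v v) \<le> c * vnorm v"
    then have "c \<in> C" using c by (simp add: C_def)
    then show "op_norm M \<le> c" unfolding op by (rule cInf_lower[OF _ bdd])
  next
    \<comment> \<open>A crude bound that shows that the set of admissible constants is nonempty, so
      that its infimum can be approached from within.\<close>
    let ?F = "\<Sum>i<dim_row M. \<Sum>k<dim_col M. cmod (M $$ (i, k))"
    have "?F \<in> C"
      unfolding C_def
    proof (intro CollectI conjI ballI)
      show "0 \<le> ?F" by (intro sum_nonneg) auto
      fix v :: "complex Matrix.vec" assume v: "v \<in> carrier_vec (dim_col M)"
      have "vnorm (M *\<^sub>v v) \<le> (\<Sum>i<dim_row M. \<bar>cmod ((M *\<^sub>v v) $ i)\<bar>)"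
        unfolding vnorm_def dim_mult_mat_vec by (rule L2_set_le_sum_abs)
      also have "\<dots> \<le> (\<Sum>i<dim_row M. \<Sum>k<dim_col M. cmod (M $$ (i, k)) * vnorm v)"
      proof (rule sum_mono)
        fix i assume i: "i \<in> {..<dim_row M}"
        have "\<bar>cmod ((M *\<^sub>v v) $ i)\<bar> = cmod (\<Sum>k<dim_col M. M $$ (i, k) * v $ k)"
          using i v mult_mat_vec_index_sum[of i M v] by simp
        also have "\<dots> \<le> (\<Sum>k<dim_col M. cmod (M $$ (i, k)) * vnorm v)"
          using v by (intro sum_norm_le) (auto simp: norm_mult intro!: mult_left_mono cmod_le_vnorm)
        finally show "\<bar>cmod ((M *\<^sub>v v) $ i)\<bar> \<le> (\<Sum>k<dim_col M. cmod (M $$ (i, k)) * vnorm v)" .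
      qed
      also have "\<dots> = ?F * vnorm v" by (simp add: sum_distrib_right)
      finally show "vnorm (M *\<^sub>v v) \<le> ?F * vnorm v" .
    qed
    then have ne: "C \<noteq> {}" by blast
    assume le: "op_norm M \<le> c"
    show "\<forall>v\<in>carrier_vec (dim_col M). vnorm (M *\<^sub>v v) \<le> c * vnorm v"
    proof (rule ballI, rule field_le_epsilon)
      fix v :: "complex Matrix.vec" and e :: real
      assume v: "v \<in> carrier_vec (dim_col M)" and e: "0 < e"
      \<comment> \<open>The added 1 keeps the denominator positive when v = 0.\<close>
      define \<delta> where "\<delta> = e / (vnorm v + 1)"
      have pos: "vnorm v + 1 > 0" by (rule add_nonneg_pos) auto
      have "\<delta> > 0" using e pos by (simp add: \<delta>_def)
      then have "Inf C < c + \<delta>" using le op by simp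
      then obtain c' where c': "c' \<in> C" "c' < c + \<delta>" using cInf_lessD[OF ne] by blast
      have "vnorm (M *\<^sub>v v) \<le> c' * vnorm v" using c'(1) v by (simp add: C_def)
      also have "\<dots> \<le> (c + \<delta>) * vnorm v" using c'(2) by (intro mult_right_mono) auto
      also have "\<dots> = c * vnorm v + \<delta> * vnorm v" by (simp add: distrib_right)
      also have "\<delta> * vnorm v \<le> e" using e pos by (simp add: \<delta>_def field_simps)
      finally show "vnorm (M *\<^sub>v v) \<le> c * vnorm v + e" by simp
    qed
  }
qed

text \<open>Evaluation at a unit vector. It converts a bound on the components of a tuple into
  bounds on their entries.\<close>

lemma cmod_index_le_of_op_norm:
  assumes "op_norm A \<le> c" "0 \<le> c" "i < dim_row A" "k < dim_col A"
  shows "cmod (A $$ (i, k)) \<le> c"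
proof -
  have 1: "vnorm (unit_vec (dim_col A) k :: complex Matrix.vec) = 1"
  proof -
    have "(vnorm (unit_vec (dim_col A) k :: complex Matrix.vec))\<^sup>2 = 1"
      using assms(4) by (simp add: vnorm_power2 unit_vec_def if_distrib[of cmod] if_distrib[of "\<lambda>x. x\<^sup>2"] cong: if_cong)
    then show ?thesis using vnorm_nonneg[of "unit_vec (dim_col A) k"]
      by (smt (verit) power2_eq_1_iff)
  qed
  have "(A *\<^sub>v unit_vec (dim_col A) k) $ i = A $$ (i, k)"
    using assms by (simp add: mult_mat_vec_index_sum unit_vec_def if_distrib[of "\<lambda>x. _ * x"] del: index_mult_mat_vec cong: if_cong)
  then have "cmod (A $$ (i, k)) \<le> vnorm (A *\<^sub>v unit_vec (dim_col A) k)"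
    using cmod_le_vnorm[of i "A *\<^sub>v unit_vec (dim_col A) k"] assms by simp
  also have "\<dots> \<le> c * vnorm (unit_vec (dim_col A) k :: complex Matrix.vec)"
    using assms(1) op_norm_le_iff[OF assms(2)] by simp
  finally show ?thesis by (simp add: 1)
qed

lemma mat_adjoint_dim [simp]: "dim_row (mat_adjoint A) = dim_col A" "dim_col (mat_adjoint A) = dim_row A"
  by (simp_all add: mat_adjoint_def)

lemma mat_adjoint_index:
  fixes A :: "complex mat"
  assumes "i < dim_col A" "j < dim_row A"
  shows "mat_adjoint A $$ (i, j) = cnj (A $$ (j, i))"
  using assms by (simp add: mat_adjoint_def mat_of_rows_index conjugate_complex_def)

text \<open>The quadratic form of \<open>I + L + L\<^sup>*\<close> at \<open>v\<close> is \<open>\<parallel>v + L v\<parallel>\<^sup>2 - \<parallel>L v\<parallel>\<^sup>2\<close>.\<close>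

lemma pos_semidef_iff_vnorm:
  assumes L: "L \<in> carrier_mat N N"
  shows "pos_semidef N (1\<^sub>m N + L + mat_adjoint L) \<longleftrightarrow>
    (\<forall>v\<in>carrier_vec N. vnorm (L *\<^sub>v v) \<le> vnorm (v + L *\<^sub>v v))"
proof -
  let ?H = "1\<^sub>m N + L + mat_adjoint L"
  have adj: "mat_adjoint L \<in> carrier_mat N N" using L by auto
  have H: "?H \<in> carrier_mat N N" using L adj by simp
  have herm: "mat_adjoint ?H = ?H"
    by (rule eq_matI) (use L in \<open>auto simp: mat_adjoint_index\<close>)
  have form: "Re ((?H *\<^sub>v v) \<bullet>c v) = (vnorm (v + L *\<^sub>v v))\<^sup>2 - (vnorm (L *\<^sub>v v))\<^sup>2"
    if v: "v \<in> carrier_vec N" for v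
  proof -
    let ?w = "L *\<^sub>v v"
    have w: "?w $ i = (\<Sum>k<N. L $$ (i, k) * v $ k)" if "i < N" for i
      using that L v by (subst mult_mat_vec_index_sum) auto
    have Hv: "(?H *\<^sub>v v) $ i = v $ i + ?w $ i + (\<Sum>k<N. cnj (L $$ (k, i)) * v $ k)" if i: "i < N" for i
    proof -
      have "(?H *\<^sub>v v) $ i = (\<Sum>k<N. ?H $$ (i, k) * v $ k)"
        using i L v by (subst mult_mat_vec_index_sum) auto
      also have "\<dots> = (\<Sum>k<N. (if i = k then v $ k else 0) + L $$ (i, k) * v $ k + cnj (L $$ (k, i)) * v $ k)"
        using i L by (intro sum.cong) (auto simp: mat_adjoint_index distrib_right)
      also have "\<dots> = v $ i + ?w $ i + (\<Sum>k<N. cnj (L $$ (k, i)) * v $ k)"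
        using i by (simp add: sum.distrib w)
      finally show ?thesis .
    qed
    \<comment> \<open>The coordinate form of <L* v, v> = <v, L v>.\<close>
    have swap: "(\<Sum>i<N. (\<Sum>k<N. cnj (L $$ (k, i)) * v $ k) * cnj (v $ i)) = (\<Sum>i<N. v $ i * cnj (?w $ i))"
    proof -
      have "(\<Sum>i<N. (\<Sum>k<N. cnj (L $$ (k, i)) * v $ k) * cnj (v $ i))
          = (\<Sum>k<N. \<Sum>i<N. v $ k * (cnj (L $$ (k, i)) * cnj (v $ i)))"
        unfolding sum_distrib_right by (subst sum.swap) (simp add: mult_ac)
      also have "\<dots> = (\<Sum>i<N. v $ i * cnj (?w $ i))"
        by (intro sum.cong) (auto simp: w sum_distrib_left)
      finally show ?thesis .
    qed
    have expand: "Re (x * cnj x + y * cnj x + x * cnj y) = (cmod (x + y))\<^sup>2 - (cmod y)\<^sup>2" for x y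
      unfolding cmod_power2 by (simp add: power2_eq_square algebra_simps)
    have "(?H *\<^sub>v v) \<bullet>c v = (\<Sum>i<N. (?H *\<^sub>v v) $ i * cnj (v $ i))"
      using v by (simp add: scalar_prod_def lessThan_atLeast0 conjugate_complex_def del: index_mult_mat_vec)
    also have "\<dots> = (\<Sum>i<N. v $ i * cnj (v $ i) + ?w $ i * cnj (v $ i)
        + (\<Sum>k<N. cnj (L $$ (k, i)) * v $ k) * cnj (v $ i))"
      by (intro sum.cong) (auto simp: Hv distrib_right)
    also have "\<dots> = (\<Sum>i<N. v $ i * cnj (v $ i) + ?w $ i * cnj (v $ i)) + (\<Sum>i<N. v $ i * cnj (?w $ i))"
      by (simp only: sum.distrib swap)
    also have "\<dots> = (\<Sum>i<N. v $ i * cnj (v $ i) + ?w $ i * cnj (v $ i) + v $ i * cnj (?w $ i))"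
      by (simp only: sum.distrib)
    finally have "Re ((?H *\<^sub>v v) \<bullet>c v) =
        (\<Sum>i<N. Re (v $ i * cnj (v $ i) + ?w $ i * cnj (v $ i) + v $ i * cnj (?w $ i)))"
      by (simp only: Re_sum)
    also have "\<dots> = (\<Sum>i<N. (cmod (v $ i + ?w $ i))\<^sup>2 - (cmod (?w $ i))\<^sup>2)"
      by (intro sum.cong refl) (rule expand)
    also have "\<dots> = (vnorm (v + ?w))\<^sup>2 - (vnorm ?w)\<^sup>2"
      using v L by (simp add: vnorm_power2 sum_subtractf del: index_mult_mat_vec)
    finally show ?thesis .
  qed
  show ?thesis
    unfolding pos_semidef_def using H herm form by (auto simp: abs_le_square_iff[symmetric])
qed

lemma spectraball_iff:
  assumes "length A = g"
  shows "X \<in> spectraball d A n \<longleftrightarrow> X \<in> mat_tuples g n \<and>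
    (\<forall>v\<in>carrier_vec (d * n). vnorm (lin_pencil d n A X *\<^sub>v v) \<le> vnorm v)"
  using assms op_norm_le_iff[of 1 "lin_pencil d n A X"] by (simp add: spectraball_def)

lemma spectrahedron_iff:
  assumes "length A = g"
  shows "X \<in> spectrahedron d A n \<longleftrightarrow> X \<in> mat_tuples g n \<and>
    (\<forall>v\<in>carrier_vec (d * n). vnorm (lin_pencil d n A X *\<^sub>v v) \<le> vnorm (v + lin_pencil d n A X *\<^sub>v v))"
  using assms by (simp add: spectrahedron_def pos_semidef_iff_vnorm[OF lin_pencil_carrier])

section \<open>Closedness of the spectrahedron\<close>

lemma tendsto_lin_pencil_vec:
  assumes A: "A \<in> mat_tuples g d" and X: "X \<in> mat_tuples g n" and v: "v \<in> carrier_vec (d * n)" and i: "i < d * n"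
  shows "((\<lambda>Y. (lin_pencil d n A Y *\<^sub>v v) $ i) \<longlongrightarrow> (lin_pencil d n A X *\<^sub>v v) $ i)
    (nhdsin (tuple_topology g n) X)"
proof -
  let ?F = "nhdsin (tuple_topology g n) X"
  have n: "n > 0" using i by (auto intro: gr0I)
  let ?\<phi> = "\<lambda>Y. \<Sum>k<d * n. (\<Sum>j<g. (A ! j) $$ (i div n, k div n) * coord Y (j, i mod n, k mod n)) * v $ k"
  have eq: "?\<phi> Y = (lin_pencil d n A Y *\<^sub>v v) $ i" if "Y \<in> mat_tuples g n" for Y
    using that i v by (simp add: mult_mat_vec_index_sum lin_pencil_index[OF A] coord_def del: index_mult_mat_vec)
  have "(?\<phi> \<longlongrightarrow> ?\<phi> X) ?F"
    using n by (intro tendsto_intros tendsto_coord[OF X]) (auto simp: coords_def)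
  then have "(?\<phi> \<longlongrightarrow> (lin_pencil d n A X *\<^sub>v v) $ i) ?F" unfolding eq[OF X] .
  then show ?thesis
    by (rule Lim_transform_eventually) (use eventually_nhdsin_tuple_in[OF X] eq in \<open>auto elim: eventually_mono\<close>)
qed

text \<open>Failure of membership is witnessed by one vector and a strict inequality, which persists
  nearby for that same vector. Closedness ensures that boundary points belong to the spectrahedron,
  where q is defined.\<close>

lemma closedin_spectrahedron:
  assumes A: "A \<in> mat_tuples g d"
  shows "closedin (tuple_topology g n) (spectrahedron d A n)"
  unfolding closedin_def openin_tuple_topology_iff_eventually topspace_tuple_topology
proof (intro conjI ballI)
  note mem = spectrahedron_iff[OF mat_tuplesD(1)[OF A]]
  show "spectrahedron d A n \<subseteq> mat_tuples g n" using mem by blast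
  fix X assume "X \<in> mat_tuples g n - spectrahedron d A n"
  then obtain v where X: "X \<in> mat_tuples g n" and v: "v \<in> carrier_vec (d * n)"
      and less: "vnorm (v + lin_pencil d n A X *\<^sub>v v) < vnorm (lin_pencil d n A X *\<^sub>v v)"
    using mem by force
  let ?F = "nhdsin (tuple_topology g n) X"
  let ?f = "\<lambda>Y. vnorm (lin_pencil d n A Y *\<^sub>v v) - vnorm (v + lin_pencil d n A Y *\<^sub>v v)"
  have 1: "vnorm (lin_pencil d n A Y *\<^sub>v v) = sqrt (\<Sum>i<d * n. (cmod ((lin_pencil d n A Y *\<^sub>v v) $ i))\<^sup>2)" for Y
    by (simp add: vnorm_def L2_set_def del: index_mult_mat_vec)
  have 2: "vnorm (v + lin_pencil d n A Y *\<^sub>v v) = sqrt (\<Sum>i<d * n. (cmod (v $ i + (lin_pencil d n A Y *\<^sub>v v) $ i))\<^sup>2)" for Y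
    using v by (simp add: vnorm_def L2_set_def del: index_mult_mat_vec)
  have "(?f \<longlongrightarrow> ?f X) ?F"
    unfolding 1 2 by (intro tendsto_intros tendsto_lin_pencil_vec[OF A X v]) auto
  then have "\<forall>\<^sub>F Y in ?F. ?f Y > 0" by (rule order_tendstoD) (use less in simp)
  with eventually_nhdsin_tuple_in[OF X]
  show "\<forall>\<^sub>F Y in ?F. Y \<in> mat_tuples g n - spectrahedron d A n"
    by eventually_elim (use v in \<open>force simp: mem\<close>)
qed blast

subsection \<open>The correspondence of the spectrahedron and the spectraball\<close>

lemma smult_mat_mult_vec:
  assumes "(A :: complex mat) \<in> carrier_mat m n" "v \<in> carrier_vec n"
  shows "(c \<cdot>\<^sub>m A) *\<^sub>v v = c \<cdot>\<^sub>v (A *\<^sub>v v)"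
  using assms by (intro eq_vecI) (auto simp: scalar_prod_def sum_distrib_left mult.assoc)

definition scale_tuple :: "complex \<Rightarrow> mtuple \<Rightarrow> mtuple" where
  "scale_tuple t X = map (\<lambda>A. t \<cdot>\<^sub>m A) X"

lemma scale_tuple_in: "X \<in> mat_tuples g n \<Longrightarrow> scale_tuple t X \<in> mat_tuples g n"
  by (auto simp: scale_tuple_def mat_tuples_def)

lemma lin_pencil_scale_tuple:
  assumes A: "A \<in> mat_tuples g d" and X: "X \<in> mat_tuples g n"
  shows "lin_pencil d n A (scale_tuple t X) = t \<cdot>\<^sub>m lin_pencil d n A X"
proof (rule eq_matI)
  fix r c assume "r < dim_row (t \<cdot>\<^sub>m lin_pencil d n A X)" "c < dim_col (t \<cdot>\<^sub>m lin_pencil d n A X)"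
  then have rc: "r < d * n" "c < d * n" by auto
  then have "0 < n" by (auto intro: gr0I)
  moreover have "(scale_tuple t X ! j) $$ (a, b) = t * (X ! j) $$ (a, b)" if "j < g" "a < n" "b < n" for j a b
    using that mat_tuplesD[OF X] by (simp add: scale_tuple_def)
  ultimately show "lin_pencil d n A (scale_tuple t X) $$ (r, c) = (t \<cdot>\<^sub>m lin_pencil d n A X) $$ (r, c)"
    using rc
    by (simp add: lin_pencil_index[OF A X] lin_pencil_index[OF A scale_tuple_in[OF X]] sum_distrib_left
        mult.left_commute)
qed auto

text \<open>An interior point can be pushed outwards along its ray; for the ball this is what
  excludes the eigenvalue 1 at interior points.\<close>

lemma interior_scale_tuple:
  assumes Y: "Y \<in> free_interior g S n"
  obtains t :: real where "t > 1" "scale_tuple (of_real t) Y \<in> S n"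
proof -
  have Yint: "Y \<in> tuple_topology g n interior_of S n" using Y by (simp add: free_interior_def)
  then have YT: "Y \<in> mat_tuples g n"
    using subsetD[OF interior_of_subset_topspace Yint] by simp
  have "\<forall>\<^sub>F Z in nhdsin (tuple_topology g n) Y. Z \<in> S n"
    unfolding eventually_nhdsin
    using Yint openin_interior_of subsetD[OF interior_of_subset]
    by (intro disjI2 exI[of _ "tuple_topology g n interior_of S n"]) auto
  then obtain \<delta> where \<delta>: "\<delta> > 0" "\<And>Z. Z \<in> mat_tuples g n \<Longrightarrow> tuple_dist g n Y Z < \<delta> \<Longrightarrow> Z \<in> S n"
    unfolding eventually_nhdsin_tuple[OF YT] by blast
  define R where "R = L2_set (\<lambda>k. cmod (coord Y k)) (coords g n)"
  have R: "R \<ge> 0" by (simp add: R_def)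
  \<comment> \<open>The dilation by 1 + e moves Y by exactly e R, where R is the Euclidean norm of
    Y. The choice keeps this below \<delta>, and R + 1 avoids division by zero.\<close>
  define e where "e = \<delta> / (2 * (R + 1))"
  have e: "e > 0" using \<delta>(1) R by (simp add: e_def)
  have coord: "coord (scale_tuple (of_real (1 + e)) Y) k = of_real (1 + e) * coord Y k" if "k \<in> coords g n" for k
    using that mat_tuplesD[OF YT] by (auto simp: coords_def coord_def scale_tuple_def)
  have "tuple_dist g n Y (scale_tuple (of_real (1 + e)) Y) = L2_set (\<lambda>k. e * cmod (coord Y k)) (coords g n)"
    unfolding tuple_dist_def
  proof (rule L2_set_cong[OF refl])
    fix k assume k: "k \<in> coords g n"
    have "coord Y k - coord (scale_tuple (of_real (1 + e)) Y) k = - (of_real e * coord Y k)"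
      unfolding coord[OF k] by (simp add: algebra_simps)
    then show "cmod (coord Y k - coord (scale_tuple (of_real (1 + e)) Y) k) = e * cmod (coord Y k)"
      using e by (simp add: norm_mult)
  qed
  also have "\<dots> = e * R" unfolding R_def using e by (simp add: L2_set_right_distrib)
  also have "\<dots> < \<delta>" using \<delta>(1) R by (simp add: e_def field_simps add_nonneg_pos)
  finally show ?thesis
    using e \<delta>(2)[OF scale_tuple_in[OF YT]] by (intro that[of "1 + e"]) auto
qed

context convexotonic_algebra
begin

abbreviation D :: free_set where "D \<equiv> spectrahedron d J"
abbreviation B :: free_set where "B \<equiv> spectraball d J"

lemmas D_iff = spectrahedron_iff[OF length_J]
lemmas B_iff = spectraball_iff[OF length_J]

lemma N_mult_vec:
  assumes "v \<in> carrier_vec (d * n)"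
  shows "N \<sigma> n X *\<^sub>v v = v + \<sigma> \<cdot>\<^sub>v (L n X *\<^sub>v v)"
proof -
  have "N \<sigma> n X *\<^sub>v v = 1\<^sub>m (d * n) *\<^sub>v v + (\<sigma> \<cdot>\<^sub>m L n X) *\<^sub>v v"
    by (rule add_mult_distrib_mat_vec[OF one_carrier_mat smult_carrier_mat[OF lin_pencil_carrier] assms])
  also have "(\<sigma> \<cdot>\<^sub>m L n X) *\<^sub>v v = \<sigma> \<cdot>\<^sub>v (L n X *\<^sub>v v)"
    by (rule smult_mat_mult_vec[OF lin_pencil_carrier assms])
  finally show ?thesis using assms by simp
qed

text \<open>A trivial kernel of \<open>N\<close> suffices, by \<open>det_M_nonzero\<close>. The
  kernel condition ends in \<open>vnorm v \<le> 0\<close> because callers reach v = 0 through norm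
  inequalities.\<close>

lemma in_dom_convexotonic:
  assumes n: "n > 0" and X: "X \<in> mat_tuples g n"
    and inj: "\<And>v. v \<in> carrier_vec (d * n) \<Longrightarrow> v + \<sigma> \<cdot>\<^sub>v (L n X *\<^sub>v v) = 0\<^sub>v (d * n) \<Longrightarrow> vnorm v \<le> 0"
  shows "X \<in> dom (convexotonic \<sigma> \<Xi> n)"
proof -
  have "Determinant.det (N \<sigma> n X) \<noteq> 0"
  proof
    assume "Determinant.det (N \<sigma> n X) = 0"
    then obtain v where v: "v \<in> carrier_vec (d * n)" "v \<noteq> 0\<^sub>v (d * n)" "N \<sigma> n X *\<^sub>v v = 0\<^sub>v (d * n)"
      using det_0_iff_vec_prod_zero_field[OF N_carrier] by blast
    then have "vnorm v \<le> 0" using inj[OF v(1)] by (simp only: N_mult_vec[OF v(1)])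
    then have "vnorm v = 0" by (rule antisym) simp
    then show False using v by (simp add: vnorm_eq_0_iff)
  qed
  then show ?thesis using det_M_nonzero[OF n X] X by (simp only: dom_convexotonic simp_thms)
qed

lemma vec_add_smult_eq_0D:
  assumes "v \<in> carrier_vec m" "w \<in> carrier_vec m" "v + (c :: complex) \<cdot>\<^sub>v w = 0\<^sub>v m"
  shows "v = (- c) \<cdot>\<^sub>v w"
proof (rule eq_vecI)
  fix i assume "i < dim_vec ((- c) \<cdot>\<^sub>v w)"
  then have i: "i < m" using assms by simp
  have "(v + c \<cdot>\<^sub>v w) $ i = 0" unfolding assms(3) using i by simp
  then have "v $ i + c * w $ i = 0" using i assms(1,2) by simp
  then show "v $ i = ((- c) \<cdot>\<^sub>v w) $ i" using i assms(2) by (simp add: eq_neg_iff_add_eq_0)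
qed (use assms in auto)

lemma L_vec_carrier [simp]: "L n X *\<^sub>v v \<in> carrier_vec (d * n)"
  by (rule carrier_vecI) simp

text \<open>If L v = -v, the inequality of the spectrahedron reads |L v| \<le> |v + L v| = 0, while
  |v| = |L v|; so -1 is not an eigenvalue.\<close>

lemma D_subset_dom:
  assumes n: "n > 0"
  shows "D n \<subseteq> dom (convexotonic 1 \<Xi> n)"
proof
  fix X assume X: "X \<in> D n"
  show "X \<in> dom (convexotonic 1 \<Xi> n)"
  proof (rule in_dom_convexotonic[OF n])
    show "X \<in> mat_tuples g n" using X by (simp only: D_iff)
    fix v assume v: "v \<in> carrier_vec (d * n)" and 0: "v + 1 \<cdot>\<^sub>v (L n X *\<^sub>v v) = 0\<^sub>v (d * n)"
    have "vnorm (L n X *\<^sub>v v) \<le> vnorm (v + L n X *\<^sub>v v)" using X v by (simp only: D_iff)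
    also have "\<dots> = 0" using 0 by (simp add: vnorm_eq_0_iff)
    finally have "vnorm (L n X *\<^sub>v v) \<le> 0" .
    moreover have "vnorm v = vnorm (L n X *\<^sub>v v)"
      using vec_add_smult_eq_0D[OF v L_vec_carrier 0] vnorm_smult[of "- 1" "L n X *\<^sub>v v"] by simp
    ultimately show "vnorm v \<le> 0" by simp
  qed
qed

text \<open>Cayley transform: if \<open>v = u + L\<^sub>X u\<close>, then \<open>u = v - L\<^sub>Y v\<close> and \<open>L\<^sub>Y v = L\<^sub>X u\<close>.\<close>

lemma D_iff_B:
  assumes XY: "convexotonic 1 \<Xi> n X = Some Y"
  shows "X \<in> D n \<longleftrightarrow> Y \<in> B n"
proof -
  have X: "X \<in> mat_tuples g n" using XY dom_convexotonic[of X 1 n] by auto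
  have Y: "Y \<in> mat_tuples g n" by (rule convexotonic_block_row(1)[OF XY])
  note YX = convexotonic_graph[OF XY]
  note XY' = mat_mult_left_right_inverse[OF N_carrier N_carrier YX]
  have sub: "L n Y *\<^sub>v v = L n X *\<^sub>v u"
    if u: "u \<in> carrier_vec (d * n)" and v: "v \<in> carrier_vec (d * n)"
      and uv: "u = v + (- 1) \<cdot>\<^sub>v (L n Y *\<^sub>v v)" "v = u + 1 \<cdot>\<^sub>v (L n X *\<^sub>v u)" for u v
  proof (rule eq_vecI)
    fix i assume "i < dim_vec (L n X *\<^sub>v u)"
    then have i: "i < d * n" by simp
    have "u $ i = v $ i - (L n Y *\<^sub>v v) $ i"
      using arg_cong[OF uv(1), of "\<lambda>x. x $ i"] i v by (simp del: index_mult_mat_vec)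
    moreover have "v $ i = u $ i + (L n X *\<^sub>v u) $ i"
      using arg_cong[OF uv(2), of "\<lambda>x. x $ i"] i u by (simp del: index_mult_mat_vec)
    ultimately show "(L n Y *\<^sub>v v) $ i = (L n X *\<^sub>v u) $ i" by simp
  qed auto
  have apply_eq: "P *\<^sub>v (Q *\<^sub>v w) = w"
    if "P * Q = 1\<^sub>m (d * n)" "P \<in> carrier_mat (d * n) (d * n)" "Q \<in> carrier_mat (d * n) (d * n)"
      "w \<in> carrier_vec (d * n)" for P Q :: "complex mat" and w
    using assoc_mult_mat_vec[OF that(2-4)] that(1,4) by simp
  show ?thesis
  proof
    assume XD: "X \<in> D n"
    have "vnorm (L n Y *\<^sub>v v) \<le> vnorm v" if v: "v \<in> carrier_vec (d * n)" for v
    proof -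
      \<comment> \<open>The matrices \<open>N 1 n X\<close> and \<open>N (- 1) n Y\<close> are
        mutually inverse, so every v comes from some u and the inequality for all u yields the one
        for all v.\<close>
      define u where "u = N (- 1) n Y *\<^sub>v v"
      have u: "u \<in> carrier_vec (d * n)" unfolding u_def by (rule mult_mat_vec_carrier[OF N_carrier v])
      have vu: "v = u + 1 \<cdot>\<^sub>v (L n X *\<^sub>v u)"
        using apply_eq[OF XY' N_carrier N_carrier v] unfolding u_def[symmetric] N_mult_vec[OF u] by (rule sym)
      have "vnorm (L n Y *\<^sub>v v) = vnorm (L n X *\<^sub>v u)"
        using sub[OF u v u_def[unfolded N_mult_vec[OF v]] vu] by simp
      also have "\<dots> \<le> vnorm (u + L n X *\<^sub>v u)" using XD u by (simp only: D_iff)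
      also have "u + L n X *\<^sub>v u = v" using vu by simp
      finally show ?thesis .
    qed
    then show "Y \<in> B n" using Y by (simp only: B_iff) blast
  next
    assume YB: "Y \<in> B n"
    have "vnorm (L n X *\<^sub>v u) \<le> vnorm (u + L n X *\<^sub>v u)" if u: "u \<in> carrier_vec (d * n)" for u
    proof -
      define v where "v = N 1 n X *\<^sub>v u"
      have v: "v \<in> carrier_vec (d * n)" unfolding v_def by (rule mult_mat_vec_carrier[OF N_carrier u])
      have uv: "u = v + (- 1) \<cdot>\<^sub>v (L n Y *\<^sub>v v)"
        using apply_eq[OF YX N_carrier N_carrier u] unfolding v_def[symmetric] N_mult_vec[OF v] by (rule sym)
      note vu = v_def[unfolded N_mult_vec[OF u]]
      have "vnorm (L n X *\<^sub>v u) = vnorm (L n Y *\<^sub>v v)"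
        using sub[OF u v uv vu] by simp
      also have "\<dots> \<le> vnorm v" using YB v by (simp only: B_iff)
      also have "v = u + L n X *\<^sub>v u" using vu by simp
      finally show ?thesis .
    qed
    then show "X \<in> D n" using X by (simp only: D_iff) blast
  qed
qed

text \<open>If the pencil at Y fixes v, then at t Y it multiplies v by t; for some t > 1 the point t
  Y is still in the ball, so t |v| \<le> |v| and v = 0.\<close>

lemma interior_B_subset_dom:
  assumes n: "n > 0"
  shows "free_interior g B n \<subseteq> dom (convexotonic (- 1) \<Xi> n)"
proof
  fix Y assume Yint: "Y \<in> free_interior g B n"
  then have Y: "Y \<in> B n" unfolding free_interior_def by (rule subsetD[OF interior_of_subset])
  then have YT: "Y \<in> mat_tuples g n" by (simp only: B_iff)
  show "Y \<in> dom (convexotonic (- 1) \<Xi> n)"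
  proof (rule in_dom_convexotonic[OF n YT])
    fix v assume v: "v \<in> carrier_vec (d * n)" and ker: "v + (- 1) \<cdot>\<^sub>v (L n Y *\<^sub>v v) = 0\<^sub>v (d * n)"
    have fix_v: "L n Y *\<^sub>v v = v" using vec_add_smult_eq_0D[OF v L_vec_carrier ker] by simp
    obtain t :: real where t: "t > 1" "scale_tuple (of_real t) Y \<in> B n"
      using interior_scale_tuple[OF Yint] by blast
    have "L n (scale_tuple (of_real t) Y) *\<^sub>v v = of_real t \<cdot>\<^sub>v v"
      by (simp only: lin_pencil_scale_tuple[OF J YT] smult_mat_mult_vec[OF lin_pencil_carrier v] fix_v)
    then have "t * vnorm v \<le> vnorm v"
      using t(2)[unfolded B_iff, THEN conjunct2, rule_format, OF v] t(1) vnorm_smult[of "of_real t" v]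
      by simp
    then show "vnorm v \<le> 0" using t(1) by (auto simp: mult_le_cancel_right2)
  qed
qed

lemma B_subset_dom:
  assumes n: "n > 0" and bounded: "free_bounded g D"
  shows "B n \<subseteq> dom (convexotonic (- 1) \<Xi> n)"
proof
  fix Y assume Y: "Y \<in> B n"
  then have YT: "Y \<in> mat_tuples g n" by (simp only: B_iff)
  obtain c0 where "\<forall>n>0. \<forall>X\<in>D n. \<forall>j<g. op_norm (X ! j) \<le> c0"
    using bounded by (auto simp: free_bounded_def)
  then have c: "\<And>X j. X \<in> D n \<Longrightarrow> j < g \<Longrightarrow> op_norm (X ! j) \<le> max c0 0" "0 \<le> max c0 0"
    using n by (auto simp: le_max_iff_disj)
  show "Y \<in> dom (convexotonic (- 1) \<Xi> n)"
  proof (rule in_dom_convexotonic[OF n YT], rule ccontr)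
    fix v assume v: "v \<in> carrier_vec (d * n)" and ker: "v + (- 1) \<cdot>\<^sub>v (L n Y *\<^sub>v v) = 0\<^sub>v (d * n)"
      and nz: "\<not> vnorm v \<le> 0"
    have fix_v: "L n Y *\<^sub>v v = v" using vec_add_smult_eq_0D[OF v L_vec_carrier ker] by simp
    have v0: "v \<noteq> 0\<^sub>v (d * n)" using nz v vnorm_eq_0_iff[of v] by auto
    \<comment> \<open>A single nonzero coordinate of v is followed. The constant K below bounds
      coordinate i of \<open>L n X *\<^sub>v v\<close> uniformly over X in \<open>D n\<close>, using
      the entry bounds supplied by boundedness.\<close>
    then obtain i where i: "i < d * n" "v $ i \<noteq> 0" using v by (auto simp: vec_eq_iff)
    define K where "K = (\<Sum>k<d * n. (\<Sum>j<g. cmod ((J ! j) $$ (i div n, k div n)) * max c0 0) * cmod (v $ k))"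
    have K: "K \<ge> 0" unfolding K_def by (intro sum_nonneg mult_nonneg_nonneg) auto
    define a where "a = cmod (v $ i)"
    have a: "a > 0" using i by (simp add: a_def)
    have LX_bound: "cmod ((L n X *\<^sub>v v) $ i) \<le> K" if X: "X \<in> D n" for X
    proof -
      have XT: "X \<in> mat_tuples g n" using X by (simp only: D_iff)
      have "(L n X *\<^sub>v v) $ i = (\<Sum>k<d * n. (\<Sum>j<g. (J ! j) $$ (i div n, k div n) * (X ! j) $$ (i mod n, k mod n)) * v $ k)"
        using i v by (simp add: mult_mat_vec_index_sum lin_pencil_index[OF J XT] del: index_mult_mat_vec)
      also have "cmod \<dots> \<le> K"
        unfolding K_def
      proof (intro sum_norm_le)
        fix k assume "k \<in> {..<d * n}"
        have "cmod (\<Sum>j<g. (J ! j) $$ (i div n, k div n) * (X ! j) $$ (i mod n, k mod n))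
            \<le> (\<Sum>j<g. cmod ((J ! j) $$ (i div n, k div n)) * max c0 0)"
        proof (rule sum_norm_le)
          fix j assume j: "j \<in> {..<g}"
          have "cmod ((X ! j) $$ (i mod n, k mod n)) \<le> max c0 0"
            using j n mat_tuplesD[OF XT] by (intro cmod_index_le_of_op_norm c X) auto
          then show "cmod ((J ! j) $$ (i div n, k div n) * (X ! j) $$ (i mod n, k mod n))
              \<le> cmod ((J ! j) $$ (i div n, k div n)) * max c0 0"
            by (simp only: norm_mult mult_left_mono norm_ge_zero)
        qed
        then show "cmod ((\<Sum>j<g. (J ! j) $$ (i div n, k div n) * (X ! j) $$ (i mod n, k mod n)) * v $ k)
            \<le> (\<Sum>j<g. cmod ((J ! j) $$ (i div n, k div n)) * max c0 0) * cmod (v $ k)"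
          by (simp only: norm_mult mult_right_mono norm_ge_zero)
      qed
      finally show ?thesis .
    qed
    \<comment> \<open>For t < 1 the pencil at t Y is a strict contraction, so X = p(t Y) exists and
      lies in \<open>D n\<close>. Coordinate i of (1 - t)(v + L v) = v, with L the pencil at X,
      gives t a = (1 - t) |(L v)_i|.\<close>
    have key: "t * a \<le> (1 - t) * K" if t: "0 < t" "t < 1" for t
    proof -
      let ?Z = "scale_tuple (of_real t) Y"
      note LZ = lin_pencil_scale_tuple[OF J YT, of "of_real t"]
      have ZT: "?Z \<in> mat_tuples g n" by (rule scale_tuple_in[OF YT])
      have LZv: "L n ?Z *\<^sub>v u = of_real t \<cdot>\<^sub>v (L n Y *\<^sub>v u)" if "u \<in> carrier_vec (d * n)" for u
        unfolding LZ by (rule smult_mat_mult_vec[OF lin_pencil_carrier that])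
      have LZ_le: "vnorm (L n ?Z *\<^sub>v u) \<le> t * vnorm u" if u: "u \<in> carrier_vec (d * n)" for u
        using Y u t unfolding LZv[OF u] vnorm_smult by (simp add: B_iff)
      have t_le: "t * vnorm u \<le> vnorm u" for u using t by (simp add: mult_left_le_one_le)
      have ZB: "?Z \<in> B n"
        unfolding B_iff using ZT by (intro conjI ballI order_trans[OF LZ_le t_le])
      have "?Z \<in> dom (convexotonic (- 1) \<Xi> n)"
      proof (rule in_dom_convexotonic[OF n ZT])
        fix u assume u: "u \<in> carrier_vec (d * n)" and ker: "u + (- 1) \<cdot>\<^sub>v (L n ?Z *\<^sub>v u) = 0\<^sub>v (d * n)"
        have "u = L n ?Z *\<^sub>v u" using vec_add_smult_eq_0D[OF u L_vec_carrier ker] by simp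
        then have "vnorm u \<le> t * vnorm u" using LZ_le[OF u] by simp
        then show "vnorm u \<le> 0" using t by (simp add: mult_le_cancel_right1)
      qed
      then obtain X where X: "convexotonic (- 1) \<Xi> n ?Z = Some X" by blast
      have "convexotonic 1 \<Xi> n X = Some ?Z" using convexotonic_inverse[OF n _ X] by simp
      then have XD: "X \<in> D n" using D_iff_B ZB by blast
      have NX: "N 1 n X * N (- 1) n ?Z = 1\<^sub>m (d * n)" using convexotonic_graph[OF X] by simp
      have "N (- 1) n ?Z *\<^sub>v v = of_real (1 - t) \<cdot>\<^sub>v v"
        unfolding N_mult_vec[OF v] LZv[OF v] fix_v using v by (intro eq_vecI) (auto simp: algebra_simps)
      then have "N 1 n X *\<^sub>v (of_real (1 - t) \<cdot>\<^sub>v v) = v"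
        using assoc_mult_mat_vec[OF N_carrier N_carrier v, of 1 X "- 1" ?Z] NX v by simp
      then have "of_real (1 - t) \<cdot>\<^sub>v (v + 1 \<cdot>\<^sub>v (L n X *\<^sub>v v)) = v"
        using mult_mat_vec[OF N_carrier v, of 1 X "of_real (1 - t)"] by (simp only: N_mult_vec[OF v])
      from arg_cong[OF this, of "\<lambda>x. x $ i"]
      have "of_real (1 - t) * (v $ i + (L n X *\<^sub>v v) $ i) = v $ i"
        using i v by (simp del: index_mult_mat_vec)
      then have "of_real t * v $ i = of_real (1 - t) * (L n X *\<^sub>v v) $ i"
        by (simp add: algebra_simps)
      then have "cmod (of_real t * v $ i) = cmod (of_real (1 - t) * (L n X *\<^sub>v v) $ i)" by (rule arg_cong)
      then have "t * a = (1 - t) * cmod ((L n X *\<^sub>v v) $ i)"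
        unfolding norm_mult norm_of_real a_def using t by simp
      also have "\<dots> \<le> (1 - t) * K" using t LX_bound[OF XD] by (intro mult_left_mono) auto
      finally show ?thesis .
    qed
    \<comment> \<open>The value of t at which t a = (1 - t) K. The midpoint of s and 1 lies strictly
      beyond it and violates \<open>key\<close>.\<close>
    define s where "s = K / (a + K)"
    define t where "t = (1 + s) / 2"
    have aK: "a + K > 0" using a K by simp
    then have "s < 1" "0 \<le> s" using a K by (auto simp: s_def)
    then have t: "0 < t" "t < 1" and t_gt: "s < t" by (auto simp: t_def)
    have "t * (a + K) \<le> K" using key[OF t(1,2)] by (simp add: algebra_simps)
    then show False using t_gt aK by (simp add: s_def pos_divide_less_eq)
  qed
qed

text \<open>The preimage of the interior of T under a continuous map with open domain is open and,
  by \<open>sub\<close>, contained in S.\<close>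

lemma interior_transfer:
  assumes XY: "convexotonic \<sigma> \<Xi> n X = Some Y"
    and sub: "\<And>X Y. convexotonic \<sigma> \<Xi> n X = Some Y \<Longrightarrow> Y \<in> T n \<Longrightarrow> X \<in> S n"
    and Y: "Y \<in> free_interior g T n"
  shows "X \<in> free_interior g S n"
proof -
  let ?D = "dom (convexotonic \<sigma> \<Xi> n)"
  let ?U = "{X \<in> topspace (subtopology (tuple_topology g n) ?D). the (convexotonic \<sigma> \<Xi> n X) \<in> free_interior g T n}"
  have "openin (subtopology (tuple_topology g n) ?D) ?U"
    by (rule openin_continuous_map_preimage[OF continuous_map_convexotonic])
      (simp add: free_interior_def)
  then have "openin (tuple_topology g n) ?U"
    unfolding openin_open_subtopology[OF openin_dom_convexotonic] by (rule conjunct1)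
  moreover have "?U \<subseteq> S n"
  proof
    fix Z assume "Z \<in> ?U"
    then have Z: "Z \<in> ?D" "the (convexotonic \<sigma> \<Xi> n Z) \<in> T n"
      using subsetD[OF interior_of_subset[of "tuple_topology g n" "T n"]] by (simp_all add: free_interior_def)
    then obtain W where "convexotonic \<sigma> \<Xi> n Z = Some W" by blast
    then show "Z \<in> S n" using sub[of Z W] Z(2) by simp
  qed
  ultimately have "?U \<subseteq> free_interior g S n"
    unfolding free_interior_def by (intro interior_of_maximal)
  moreover have "X \<in> ?U" using XY Y dom_convexotonic[of X \<sigma> n] by auto
  ultimately show ?thesis by (rule subsetD)
qed

lemma p_iff_q:
  assumes "n > 0"
  shows "convexotonic (- 1) \<Xi> n Y = Some X \<longleftrightarrow> convexotonic 1 \<Xi> n X = Some Y"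
proof
  show "convexotonic 1 \<Xi> n X = Some Y" if "convexotonic (- 1) \<Xi> n Y = Some X"
    using convexotonic_inverse[OF assms _ that] by simp
  show "convexotonic (- 1) \<Xi> n Y = Some X" if "convexotonic 1 \<Xi> n X = Some Y"
    by (rule convexotonic_inverse[OF assms _ that]) simp
qed

text \<open>Interiors are only ever pulled back: that of the spectrahedron along p, that of the ball
  along q.\<close>

lemma interior_D_iff_B:
  assumes n: "n > 0" and XY: "convexotonic 1 \<Xi> n X = Some Y"
  shows "X \<in> free_interior g D n \<longleftrightarrow> Y \<in> free_interior g B n"
proof
  show "Y \<in> free_interior g B n" if X: "X \<in> free_interior g D n"
  proof (rule interior_transfer[OF _ _ X])
    show "convexotonic (- 1) \<Xi> n Y = Some X" using XY p_iff_q[OF n] by simp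
    show "Y \<in> B n" if "convexotonic (- 1) \<Xi> n Y = Some X" "X \<in> D n" for X Y
      using that D_iff_B p_iff_q[OF n] by simp
  qed
  show "X \<in> free_interior g D n" if Y: "Y \<in> free_interior g B n"
    by (rule interior_transfer[OF XY _ Y]) (simp add: D_iff_B)
qed

text \<open>Reduces bianalyticity to two domain inclusions and a pointwise equivalence on the graph
  of q, so that it applies to the interiors and to the full sets alike.\<close>

lemma bianalytic_convexotonic:
  assumes S: "\<And>n. n > 0 \<Longrightarrow> S n \<subseteq> dom (convexotonic 1 \<Xi> n)"
    and T: "\<And>n. n > 0 \<Longrightarrow> T n \<subseteq> dom (convexotonic (- 1) \<Xi> n)"
    and ST: "\<And>n X Y. n > 0 \<Longrightarrow> convexotonic 1 \<Xi> n X = Some Y \<Longrightarrow> X \<in> S n \<longleftrightarrow> Y \<in> T n"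
  shows "bianalytic g S T (convexotonic 1 \<Xi>) (convexotonic (- 1) \<Xi>)"
proof -
  have q: "\<exists>Y. convexotonic 1 \<Xi> n X = Some Y \<and> Y \<in> T n \<and> convexotonic (- 1) \<Xi> n Y = Some X"
    if n: "n > 0" and X: "X \<in> S n" for n X
  proof -
    obtain Y where Y: "convexotonic 1 \<Xi> n X = Some Y" using domD[OF subsetD[OF S[OF n] X]] by blast
    then show ?thesis using ST[OF n Y, THEN iffD1, OF X] p_iff_q[OF n, THEN iffD2, OF Y] by auto
  qed
  have p: "\<exists>X. convexotonic (- 1) \<Xi> n Y = Some X \<and> X \<in> S n \<and> convexotonic 1 \<Xi> n X = Some Y"
    if n: "n > 0" and Y: "Y \<in> T n" for n Y
  proof -
    obtain X where X: "convexotonic (- 1) \<Xi> n Y = Some X" using domD[OF subsetD[OF T[OF n] Y]] by blast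
    note XY = p_iff_q[OF n, THEN iffD1, OF X]
    then show ?thesis using ST[OF n XY, THEN iffD2, OF Y] X by auto
  qed
  show ?thesis
    unfolding bianalytic_def free_maps_into_def
  proof (intro conjI allI impI ballI)
    fix n X assume "0 < n" "X \<in> S n"
    from q[OF this] obtain Y where Y: "convexotonic 1 \<Xi> n X = Some Y" "Y \<in> T n"
      "convexotonic (- 1) \<Xi> n Y = Some X" by blast
    then show "\<exists>Y\<in>T n. convexotonic 1 \<Xi> n X = Some Y" by auto
    show "convexotonic (- 1) \<Xi> n (the (convexotonic 1 \<Xi> n X)) = Some X" using Y by simp
  next
    fix n Y assume "0 < n" "Y \<in> T n"
    from p[OF this] obtain X where X: "convexotonic (- 1) \<Xi> n Y = Some X" "X \<in> S n"
      "convexotonic 1 \<Xi> n X = Some Y" by blast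
    then show "\<exists>X\<in>S n. convexotonic (- 1) \<Xi> n Y = Some X" by auto
    show "convexotonic 1 \<Xi> n (the (convexotonic (- 1) \<Xi> n Y)) = Some Y" using X by simp
  qed (rule free_mapping_convexotonic[OF S] free_analytic_on_convexotonic[OF S]
      free_mapping_convexotonic[OF T] free_analytic_on_convexotonic[OF T], assumption)+
qed

text \<open>The preimage of a compact set under q is its image under the continuous inverse
  p.\<close>

lemma bianalytic_imp_free_proper:
  assumes bi: "bianalytic g S T (convexotonic 1 \<Xi>) (convexotonic (- 1) \<Xi>)"
  shows "free_proper g S T (convexotonic 1 \<Xi>)"
  unfolding free_proper_def
proof (intro conjI allI impI)
  show "free_maps_into S T (convexotonic 1 \<Xi>)" using bi by (simp add: bianalytic_def)
  fix n K assume n: "0 < n" and "compactin (subtopology (tuple_topology g n) (T n)) K"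
  then have K: "compactin (tuple_topology g n) K" "K \<subseteq> T n" by (auto simp: compactin_subtopology)
  let ?p = "\<lambda>Y. the (convexotonic (- 1) \<Xi> n Y)" and ?q = "\<lambda>X. the (convexotonic 1 \<Xi> n X)"
  have into: "free_maps_into T S (convexotonic (- 1) \<Xi>)"
    using bi unfolding bianalytic_def by (elim conjE)
  have pq: "\<forall>n>0. \<forall>X\<in>S n. convexotonic (- 1) \<Xi> n (the (convexotonic 1 \<Xi> n X)) = Some X"
    using bi unfolding bianalytic_def by (elim conjE)
  have qp: "\<forall>n>0. \<forall>Y\<in>T n. convexotonic 1 \<Xi> n (the (convexotonic (- 1) \<Xi> n Y)) = Some Y"
    using bi unfolding bianalytic_def by (elim conjE)
  have p: "Y \<in> dom (convexotonic (- 1) \<Xi> n)" "?p Y \<in> S n" if Y: "Y \<in> T n" for Y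
  proof -
    obtain X where "X \<in> S n" "convexotonic (- 1) \<Xi> n Y = Some X"
      using into[unfolded free_maps_into_def, rule_format, OF n Y] by (elim bexE)
    then show "Y \<in> dom (convexotonic (- 1) \<Xi> n)" "?p Y \<in> S n" by auto
  qed
  have qp: "?q (?p Y) = Y" if "Y \<in> T n" for Y
    using qp[rule_format, OF n that] by simp
  have pq: "?p (?q X) = X" if "X \<in> S n" for X
    using pq[rule_format, OF n that] by simp
  have "{X \<in> S n. ?q X \<in> K} = ?p ` K"
  proof (intro equalityI subsetI)
    fix X assume "X \<in> {X \<in> S n. ?q X \<in> K}"
    then show "X \<in> ?p ` K" using pq[of X] by (intro image_eqI[of X ?p "?q X"]) simp_all
  next
    fix X assume "X \<in> ?p ` K"
    then obtain Y where Y: "Y \<in> K" "X = ?p Y" by blast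
    then have "Y \<in> T n" using K(2) by blast
    then show "X \<in> {X \<in> S n. ?q X \<in> K}" using Y p(2) qp by simp
  qed
  moreover have "compactin (tuple_topology g n) (?p ` K)"
  proof (rule image_compactin[OF _ continuous_map_convexotonic])
    show "compactin (subtopology (tuple_topology g n) (dom (convexotonic (- 1) \<Xi> n))) K"
      unfolding compactin_subtopology using K p(1) by blast
  qed
  ultimately have "compactin (tuple_topology g n) {X \<in> S n. ?q X \<in> K}" by simp
  then show "compactin (subtopology (tuple_topology g n) (S n)) {X \<in> S n. ?q X \<in> K}"
    unfolding compactin_subtopology by blast
qed

text \<open>Because the spectrahedron is closed, its boundary consists of its non-interior points.
  By the two pointwise equivalences their images lie in the ball but not in its interior.\<close>

lemma boundary_into: "free_maps_into (free_boundary g D) (free_boundary g B) (convexotonic 1 \<Xi>)"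
  unfolding free_maps_into_def
proof (intro allI impI ballI)
  fix n X assume n: "0 < n" and "X \<in> free_boundary g D n"
  then have X: "X \<in> D n" "X \<notin> free_interior g D n"
    unfolding free_boundary_def free_interior_def frontier_of_def
      closure_of_closedin[OF closedin_spectrahedron[OF J]] by blast+
  then obtain Y where Y: "convexotonic 1 \<Xi> n X = Some Y" using D_subset_dom[OF n] by blast
  have "Y \<in> B n" using X(1) D_iff_B[OF Y] by simp
  moreover have "Y \<notin> free_interior g B n" using X(2) interior_D_iff_B[OF n Y] by simp
  moreover have "B n \<subseteq> tuple_topology g n closure_of B n"
    by (rule closure_of_subset) (auto simp: B_iff)
  ultimately have "Y \<in> free_boundary g B n"
    unfolding free_boundary_def free_interior_def frontier_of_def by blast
  then show "\<exists>Y\<in>free_boundary g B n. convexotonic 1 \<Xi> n X = Some Y" using Y by blast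
qed

end

theorem proposition1p3:
  fixes g d :: nat and J \<Xi> :: "complex mat list"
  assumes J: "J \<in> mat_tuples g d"
    and indep: "lin_indep_tuple d J"
    and alg: "spans_algebra d J"
    and \<Xi>: "\<Xi> \<in> mat_tuples g g"
    and J_mult: "\<And>j k. j < g \<Longrightarrow> k < g \<Longrightarrow>
      J ! k * J ! j = lin_comb d (\<lambda>s. (\<Xi> ! j) $$ (k, s)) J"
  defines "q \<equiv> convexotonic_q \<Xi>"
    and "p \<equiv> convexotonic_p \<Xi>"
    and "\<D> \<equiv> spectrahedron d J"
    and "\<B> \<equiv> spectraball d J"
  shows "(\<forall>n>0. \<D> n \<subseteq> dom (q n))
    \<and> bianalytic g (free_interior g \<D>) (free_interior g \<B>) q p
    \<and> free_maps_into (free_interior g \<B>) (free_interior g \<D>) p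
    \<and> free_proper g (free_interior g \<D>) (free_interior g \<B>) q
    \<and> free_maps_into (free_boundary g \<D>) (free_boundary g \<B>) q
    \<and> (free_bounded g \<D> \<longrightarrow>
         bianalytic g \<D> \<B> q p \<and> (\<forall>n>0. \<B> n \<subseteq> dom (p n)))"
proof -
  interpret convexotonic_algebra g d J \<Xi>
    using J indep \<Xi> J_mult by unfold_locales
  have qp: "q = convexotonic 1 \<Xi>" "p = convexotonic (- 1) \<Xi>"
    by (simp_all add: q_def p_def convexotonic_q_eq convexotonic_p_eq)
  have int_D: "free_interior g D n \<subseteq> dom (convexotonic 1 \<Xi> n)" if "n > 0" for n
    unfolding free_interior_def by (rule order_trans[OF interior_of_subset D_subset_dom[OF that]])
  have bi: "bianalytic g (free_interior g D) (free_interior g B) q p"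
    unfolding qp by (rule bianalytic_convexotonic[OF int_D interior_B_subset_dom interior_D_iff_B])
  \<comment> \<open>Boundedness enters through the domain inclusion for p, the one ingredient that
    the dilation argument gives only on the interior.\<close>
  have bi_bounded: "bianalytic g D B q p" if "free_bounded g D"
    unfolding qp by (rule bianalytic_convexotonic[OF D_subset_dom B_subset_dom[OF _ that] D_iff_B])
  have "free_proper g (free_interior g D) (free_interior g B) q"
    using bi unfolding qp by (rule bianalytic_imp_free_proper)
  moreover have "free_maps_into (free_interior g B) (free_interior g D) p"
    using bi unfolding bianalytic_def by (elim conjE)
  moreover have "\<forall>n>0. D n \<subseteq> dom (q n)" unfolding qp by (intro allI impI D_subset_dom)
  moreover have "\<forall>n>0. B n \<subseteq> dom (p n)" if "free_bounded g D"
    unfolding qp by (intro allI impI B_subset_dom that)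
  moreover have "free_maps_into (free_boundary g D) (free_boundary g B) q"
    unfolding qp by (rule boundary_into)
  ultimately show ?thesis
    unfolding \<D>_def \<B>_def using bi bi_bounded by (intro conjI impI)
qed

end
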